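(* Let $\Omega$ be a locally compact metrizable space and let $p\in\partial^{(\infty)}(\Omega^\flat)$. Then there exists a non-redundant pseudo-finite family $(\mathcal{P}_\alpha:\alpha\in\mathfrak{c})$ of prime $z$-filters on $\Omega$, each supported at $p$. Moreover, (for this family) by setting $P_\alpha=C_0(\Omega)\cap \mathbf{Z}^{-1}[\mathcal{P}_\alpha]$ one obtains a non-redundant pseudo-finite family $(P_\alpha:\alpha\in\mathfrak{c})$ of prime $z$-ideals in $C_0(\Omega)$, each supported at $p$, such that $$\Big|C_0(\Omega)\Big/\bigcap_{\alpha\in\mathfrak{c}}P_\alpha\Big|=\mathfrak{c}.$$
   Context: Topological spaces are Hausdorff. $\mathfrak{c}=2^{\aleph_0}$, identified with the smallest ordinal of that cardinality. $\Omega^\flat$ is the one-point compactification of $\Omega$ (the added point is "the point at infinity"). $C(\Omega)$ is the algebra of continuous scalar-valued functions on $\Omega$ and $C_0(\Omega)$ the subalgebra of those vanishing at infinity (scalar field real or complex, fixed). Derived sets: for a compact space $K$, $\partial^{(1)}K=\partial K$ is the set of all limit points of $K$, $\partial^{(n+1)}K=\partial(\partial^{(n)}K)$ for $n\ge1$, and $\partial^{(\infty)}K=\bigcap_{n\ge1}\partial^{(n)}K$. Zero sets: $\mathbf{Z}(f)=f^{-1}(0)$ and $\mathbf{Z}[\Omega]=\{\mathbf{Z}(f):f\in C(\Omega)\}$. A $z$-filter on $\Omega$ is a non-empty proper subset of $\mathbf{Z}[\Omega]$ closed under finite intersections and under supersets belonging to $\mathbf{Z}[\Omega]$. A $z$-filter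 $\mathcal{P}$ is prime if $Z_1\cup Z_2\notin\mathcal{P}$ whenever $Z_1,Z_2\in\mathbf{Z}[\Omega]\setminus\mathcal{P}$. For a $z$-filter $\mathcal{F}$, $\mathbf{Z}^{-1}[\mathcal{F}]=\{f\in C(\Omega):\mathbf{Z}(f)\in\mathcal{F}\}$. An ideal $I$ of $C_0(\Omega)$ is a $z$-ideal if $g\in I$ whenever $g\in C_0(\Omega)$, $f\in I$ and $\mathbf{Z}(g)\supset\mathbf{Z}(f)$. Prime ideals are proper. Support: a prime $z$-filter $\mathcal{P}$ is supported at $p\in\Omega$ if $p\in Z$ for all $Z\in\mathcal{P}$, and supported at the point at infinity if no such $p\in\Omega$ exists. A prime ideal $P$ of $C_0(\Omega)$ is supported at $p\in\Omega$ if $f(p)=0$ for all $f\in P$, and supported at infinity if no such $p\in\Omega$ exists. A family $(P_i)_{i\in S}$ of prime ideals in $C_0(\Omega)$ is pseudo-finite if every $f\in\bigcup_{i\in S}P_i$ belongs to $P_i$ for all but finitely many $i\in S$. A pseudo-finite family is non-redundant if $\bigcap_{i\in T}P_i\ne\bigcap_{i\in S}P_i$ for every proper subset $T$ of $S$. The same definitions are used for families of prime $z$-filters on $\Omega$ (with zero sets $Z$ in place of functions $f$). *)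

theory Defs
  imports "HOL-Analysis.Analysis"
begin

text \<open>
  The scalar field. Up to isometric isomorphism the instances of this class are exactly
  the real and the complex numbers: the norm is multiplicative and extends the absolute
  value on the scalars coming from \<^typ>\<open>real\<close>, which leaves only the usual
  modulus in the second case.
\<close>

class real_or_complex = real_normed_field +
  assumes real_or_complex:
    "(\<forall>x. \<exists>a. x = a *\<^sub>R 1) \<or>
     (\<exists>i. i * i = - 1 \<and> (\<forall>x. \<exists>a b. x = a *\<^sub>R 1 + b *\<^sub>R i))"

instance real :: real_or_complex
  by standard simp

instance complex :: real_or_complex
proof
  have "\<exists>a b. x = a *\<^sub>R 1 + b *\<^sub>R \<i>" for x :: complex
    by (rule exI[of _ "Re x"], rule exI[of _ "Im x"]) (simp add: complex_eq_iff)
  moreover have "\<i> * \<i> = - 1"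
    by simp
  ultimately show "(\<forall>x::complex. \<exists>a. x = a *\<^sub>R 1) \<or>
      (\<exists>i::complex. i * i = - 1 \<and> (\<forall>x. \<exists>a b. x = a *\<^sub>R 1 + b *\<^sub>R i))"
    by blast
qed

text \<open>
  The cardinal two to the power aleph-zero, as a well-order of minimal order type; the
  elements of the corresponding ordinal are represented by the field of this well-order.
\<close>

definition continuum :: "(nat \<Rightarrow> bool) rel" where
  "continuum = BNF_Cardinal_Arithmetic.cexp BNF_Cardinal_Arithmetic.ctwo natLeq"

text \<open>
  Iterated derived sets, with index 0 for the whole space. Limit points are taken in the
  ambient space. In the compact spaces considered here each derived set is closed, so
  this agrees with the limit points of the previous derived set as a space of its own.
\<close>

definition iterated_derived_set :: "nat \<Rightarrow> 'b topology \<Rightarrow> 'b set" where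
  "iterated_derived_set n X = ((\<lambda>S. X derived_set_of S) ^^ n) (topspace X)"

definition infinite_derived_set :: "'b topology \<Rightarrow> 'b set" where
  "infinite_derived_set X = (\<Inter>n\<in>{1..}. iterated_derived_set n X)"

definition C_fun :: "('a::topological_space \<Rightarrow> 'k::real_or_complex) set" where
  "C_fun = {f. continuous_on UNIV f}"

definition C0_fun :: "('a::topological_space \<Rightarrow> 'k::real_or_complex) set" where
  "C0_fun = {f \<in> C_fun. \<forall>e>0. compact {x. e \<le> norm (f x)}}"

definition zero_set :: "('a \<Rightarrow> 'k::zero) \<Rightarrow> 'a set" where
  "zero_set f = {x. f x = 0}"

definition zero_sets :: "'k::real_or_complex itself \<Rightarrow> 'a::topological_space set set" where
  "zero_sets _ = zero_set ` (C_fun :: ('a \<Rightarrow> 'k) set)"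

definition z_filter ::
  "'k::real_or_complex itself \<Rightarrow> 'a::topological_space set set \<Rightarrow> bool" where
  "z_filter k F \<longleftrightarrow> F \<noteq> {} \<and> F \<subset> zero_sets k \<and>
     (\<forall>Z1\<in>F. \<forall>Z2\<in>F. Z1 \<inter> Z2 \<in> F) \<and>
     (\<forall>Z1\<in>F. \<forall>Z2\<in>zero_sets k. Z1 \<subseteq> Z2 \<longrightarrow> Z2 \<in> F)"

definition prime_z_filter ::
  "'k::real_or_complex itself \<Rightarrow> 'a::topological_space set set \<Rightarrow> bool" where
  "prime_z_filter k F \<longleftrightarrow> z_filter k F \<and>
     (\<forall>Z1 \<in> zero_sets k - F. \<forall>Z2 \<in> zero_sets k - F. Z1 \<union> Z2 \<notin> F)"

definition Z_inverse ::
  "'a::topological_space set set \<Rightarrow> ('a \<Rightarrow> 'k::real_or_complex) set" where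
  "Z_inverse F = {f \<in> C_fun. zero_set f \<in> F}"

text \<open>
  Without compactness there is no unit, so the ring-theoretic ideals of HOL-Algebra, which
  live in unital rings, do not apply. Ideals are those of an algebra, that is, closed
  under scalar multiples as well.
\<close>

definition C0_ideal :: "('a::topological_space \<Rightarrow> 'k::real_or_complex) set \<Rightarrow> bool" where
  "C0_ideal I \<longleftrightarrow> I \<subseteq> C0_fun \<and> (\<lambda>x. 0) \<in> I \<and>
     (\<forall>f\<in>I. \<forall>g\<in>I. (\<lambda>x. f x + g x) \<in> I) \<and>
     (\<forall>c. \<forall>f\<in>I. (\<lambda>x. c * f x) \<in> I) \<and>
     (\<forall>f\<in>I. \<forall>g\<in>C0_fun. (\<lambda>x. g x * f x) \<in> I)"

definition C0_prime_ideal ::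
  "('a::topological_space \<Rightarrow> 'k::real_or_complex) set \<Rightarrow> bool" where
  "C0_prime_ideal I \<longleftrightarrow> C0_ideal I \<and> I \<noteq> C0_fun \<and>
     (\<forall>f\<in>C0_fun. \<forall>g\<in>C0_fun. (\<lambda>x. f x * g x) \<in> I \<longrightarrow> f \<in> I \<or> g \<in> I)"

definition C0_z_ideal :: "('a::topological_space \<Rightarrow> 'k::real_or_complex) set \<Rightarrow> bool" where
  "C0_z_ideal I \<longleftrightarrow> C0_ideal I \<and>
     (\<forall>g\<in>C0_fun. \<forall>f\<in>I. zero_set f \<subseteq> zero_set g \<longrightarrow> g \<in> I)"

text \<open>
  Points of the one-point compactification are of type \<^typ>\<open>'a option\<close>, with
  \<^term>\<open>None\<close> for the point at infinity.
\<close>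

definition z_filter_supported_at :: "'a set set \<Rightarrow> 'a option \<Rightarrow> bool" where
  "z_filter_supported_at F p \<longleftrightarrow>
     (case p of Some x \<Rightarrow> \<forall>Z\<in>F. x \<in> Z | None \<Rightarrow> \<not> (\<exists>x. \<forall>Z\<in>F. x \<in> Z))"

definition ideal_supported_at :: "('a \<Rightarrow> 'k::zero) set \<Rightarrow> 'a option \<Rightarrow> bool" where
  "ideal_supported_at I p \<longleftrightarrow>
     (case p of Some x \<Rightarrow> \<forall>f\<in>I. f x = 0 | None \<Rightarrow> \<not> (\<exists>x. \<forall>f\<in>I. f x = 0))"

definition pseudo_finite :: "'i set \<Rightarrow> ('i \<Rightarrow> 'b set) \<Rightarrow> bool" where
  "pseudo_finite S P \<longleftrightarrow> (\<forall>f \<in> (\<Union>i\<in>S. P i). finite {i \<in> S. f \<notin> P i})"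

text \<open>
  The ambient set \<open>A\<close> (all zero sets, or all functions vanishing at infinity) is the
  value of the intersection of the empty subfamily.
\<close>

definition non_redundant :: "'b set \<Rightarrow> 'i set \<Rightarrow> ('i \<Rightarrow> 'b set) \<Rightarrow> bool" where
  "non_redundant A S P \<longleftrightarrow>
     (\<forall>T. T \<subset> S \<longrightarrow> A \<inter> (\<Inter>i\<in>T. P i) \<noteq> A \<inter> (\<Inter>i\<in>S. P i))"

definition C0_quotient ::
  "('a::topological_space \<Rightarrow> 'k::real_or_complex) set \<Rightarrow> ('a \<Rightarrow> 'k) set set" where
  "C0_quotient I =
     C0_fun // {(f, g). f \<in> C0_fun \<and> g \<in> C0_fun \<and> (\<lambda>x. f x - g x) \<in> I}"

end

theory Submission
  imports Defs
begin

text \<open>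
  Prime \<open>z\<close>-filters correspond, by complements, to prime filters of open sets. A label is a pair
  \<open>(\<alpha>, F)\<close> of a point \<open>\<alpha>\<close> of Cantor space and a finite set \<open>F\<close> containing \<open>\<alpha>\<close>, both truncated to
  length \<open>n\<close>; a countable set of points near \<open>p\<close> is labelled so that a point labelled \<open>(\<alpha>, G)\<close> is a
  limit of points with label \<open>(\<beta>, F)\<close> for every \<open>F \<subseteq> G - {\<alpha>}\<close> and has a neighbourhood with no further
  labels. A label with \<open>card F = m\<close> asks for a point of the \<open>m\<close>-th derived set at most, so all labels
  are available near \<open>p\<close>.

  Call a set \<open>\<alpha>\<close>-positive if for arbitrarily large finite \<open>G\<close> it contains, for infinitely many \<open>n\<close>,
  points labelled \<open>(\<alpha>, G)\<close>. An open set that is \<open>\<beta>\<close>-positive for infinitely many \<open>\<beta>\<close> is \<open>\<alpha>\<close>-positive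
  for every \<open>\<alpha>\<close>: given \<open>F\<close>, choose such a \<open>\<beta>\<close> outside \<open>F\<close> and a \<open>G\<close> containing \<open>F\<close> and \<open>\<beta>\<close>; then
  points labelled \<open>(\<alpha>, F)\<close> accumulate at points labelled \<open>(\<beta>, G)\<close>. On the other hand the points
  labelled \<open>(\<alpha>, G)\<close> have an open neighbourhood that is \<open>\<beta>\<close>-positive for no \<open>\<beta> \<noteq> \<alpha>\<close>. Let \<open>Q\<close> be
  maximal among the filters of open sets that are positive for all \<open>\<alpha>\<close>, and \<open>\<U>\<^sub>\<alpha> \<supseteq> Q\<close> maximal
  among the filters of \<open>\<alpha>\<close>-positive open sets. If \<open>U \<notin> Q\<close>, then \<open>U \<inter> V\<close> is \<open>\<alpha>\<close>-positive for only
  finitely many \<open>\<alpha>\<close> for some \<open>V \<in> Q\<close>, so \<open>U\<close> lies in only finitely many \<open>\<U>\<^sub>\<alpha>\<close>.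

  Functions that agree at the countably many labelled points are congruent modulo the intersection
  of the ideals, which bounds the quotient by the continuum.
\<close>

subsection \<open>Labellings and positive sets\<close>

type_synonym label = "bool list \<times> bool list set"

definition labels :: "label set" where
  "labels = {(s, F). finite F \<and> s \<in> F \<and> (\<forall>t\<in>F. length t = length s)}"

text \<open>For members of \<open>labels\<close>, removing \<open>fst l\<close> makes the finite set
  shrink strictly, which permits induction on its size, and keeps \<open>fst l'\<close> different
  from \<open>fst l\<close>. The length of truncation is the same for both labels.\<close>

definition below :: "label \<Rightarrow> label \<Rightarrow> bool" where
  "below l' l \<longleftrightarrow> snd l' \<subseteq> snd l - {fst l}"

text \<open>The first condition on a labelled point makes positivity spread from one \<alpha> to
  another. The second limits this spread and so allows different \<alpha> to be separated.
  \<open>None\<close> marks unlabelled points.\<close>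

definition labelling :: "('a::topological_space \<Rightarrow> label option) \<Rightarrow> bool" where
  "labelling lam \<longleftrightarrow> countable (dom lam) \<and> ran lam \<subseteq> labels \<and>
     (\<forall>y l. lam y = Some l \<longrightarrow>
        (\<forall>l'\<in>labels. below l' l \<longrightarrow> y \<in> closure {z. lam z = Some l'}) \<and>
        (\<exists>N. open N \<and> y \<in> N \<and> (\<forall>z\<in>N. \<forall>l'. lam z = Some l' \<longrightarrow> l' = l \<or> below l' l)))"

lemma countable_labels: "countable labels"
proof -
  have "countable ((UNIV :: bool list set) \<times> (Collect finite :: bool list set set))"
    by (intro countable_SIGMA countable_Collect_finite) simp
  then show ?thesis
    by (rule countable_subset[rotated]) (auto simp: labels_def)
qed

lemma labelsD:
  assumes "l \<in> labels"
  shows "finite (snd l)" "fst l \<in> snd l" "\<And>t. t \<in> snd l \<Longrightarrow> length t = length (fst l)"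
proof -
  obtain s F where l: "l = (s, F)" and F: "finite F" "s \<in> F" "\<forall>t\<in>F. length t = length s"
    using assms unfolding labels_def by blast
  show "finite (snd l)" "fst l \<in> snd l" using F(1,2) by (auto simp: l)
  show "length t = length (fst l)" if "t \<in> snd l" for t
    using that F(3) unfolding l fst_conv snd_conv by blast
qed

lemma below_trans: "below l'' l' \<Longrightarrow> below l' l \<Longrightarrow> below l'' l"
  by (auto simp: below_def)

lemma labellingI:
  assumes "countable (dom lam)" "ran lam \<subseteq> labels"
    and "\<And>y l l'. lam y = Some l \<Longrightarrow> l' \<in> labels \<Longrightarrow> below l' l \<Longrightarrow>
           y \<in> closure {z. lam z = Some l'}"
    and "\<And>y l. lam y = Some l \<Longrightarrow>
           \<exists>N. open N \<and> y \<in> N \<and> (\<forall>z\<in>N. \<forall>l'. lam z = Some l' \<longrightarrow> l' = l \<or> below l' l)"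
  shows "labelling lam"
  unfolding labelling_def using assms by metis

lemma labelling_closure:
  assumes "labelling lam" "lam y = Some l" "l' \<in> labels" "below l' l"
  shows "y \<in> closure {z. lam z = Some l'}"
  using assms unfolding labelling_def by blast

lemma labelling_nbhd:
  assumes "labelling lam" "lam y = Some l"
  obtains N where "open N" "y \<in> N" "\<And>z l'. z \<in> N \<Longrightarrow> lam z = Some l' \<Longrightarrow> l' = l \<or> below l' l"
  using assms unfolding labelling_def by metis

lemma labelling_in_labels: "labelling lam \<Longrightarrow> lam y = Some l \<Longrightarrow> l \<in> labels"
  unfolding labelling_def by (auto simp: ran_def)

section \<open>Gluing labellings along disjoint open sets\<close>

definition glue :: "('i \<Rightarrow> 'a set) \<Rightarrow> ('i \<Rightarrow> 'a \<Rightarrow> 'b option) \<Rightarrow> 'a \<Rightarrow> 'b option" where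
  "glue B L y = (if \<exists>k. y \<in> B k then L (SOME k. y \<in> B k) y else None)"

lemma glue_eq:
  assumes "disjoint_family B" "y \<in> B k"
  shows "glue B L y = L k y"
proof -
  have "(SOME k. y \<in> B k) = k"
    using assms by (intro some_equality) (auto simp: disjoint_family_on_def)
  then show ?thesis using assms by (auto simp: glue_def)
qed

text \<open>Both conditions on a labelled point are local, and on the open set \<open>B k\<close>
  the glued map is \<open>L k\<close>. A countable index type keeps the set of labelled points
  countable.\<close>

lemma labelling_glue:
  fixes L :: "'i::countable \<Rightarrow> 'a::topological_space \<Rightarrow> label option"
  assumes B: "disjoint_family B" "\<And>k. open (B k)"
    and L: "\<And>k. labelling (L k)" "\<And>k. dom (L k) \<subseteq> B k"
  shows "labelling (glue B L)"
proof -
  note eq = glue_eq[OF B(1), where L = L]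
  have cases: "\<exists>k. y \<in> B k \<and> L k y = Some l" if "glue B L y = Some l" for y l
    using that eq unfolding glue_def by (metis option.distinct(1) some_eq_ex)
  have mono: "glue B L y = Some l" if "L k y = Some l" for y l k
    using that L(2)[of k] eq[of y k] by (metis domI subsetD)
  have "dom (glue B L) \<subseteq> (\<Union>k. dom (L k))"
    using cases unfolding dom_def by blast
  then have "countable (dom (glue B L))"
    using L(1) by (rule_tac countable_subset) (auto simp: labelling_def)
  moreover have "ran (glue B L) \<subseteq> labels"
    using cases labelling_in_labels[OF L(1)] unfolding ran_def by blast
  moreover have "y \<in> closure {z. glue B L z = Some l'}"
    if "glue B L y = Some l" "l' \<in> labels" "below l' l" for y l l'
  proof -
    from cases[OF that(1)] obtain k where "L k y = Some l" by auto
    then have "y \<in> closure {z. L k z = Some l'}"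
      using labelling_closure L(1) that by blast
    moreover have "{z. L k z = Some l'} \<subseteq> {z. glue B L z = Some l'}"
      using mono by blast
    ultimately show ?thesis using closure_mono by blast
  qed
  moreover have "\<exists>N. open N \<and> y \<in> N \<and> (\<forall>z\<in>N. \<forall>l'. glue B L z = Some l' \<longrightarrow> l' = l \<or> below l' l)"
    if "glue B L y = Some l" for y l
  proof -
    from cases[OF that(1)] obtain k where k: "y \<in> B k" "L k y = Some l" by auto
    obtain N where "open N" "y \<in> N"
      "\<And>z l'. z \<in> N \<Longrightarrow> L k z = Some l' \<Longrightarrow> l' = l \<or> below l' l"
      using labelling_nbhd[OF L(1) k(2)] by metis
    then show ?thesis
      using k B(2) eq by (intro exI[of _ "N \<inter> B k"]) (metis IntE IntI open_Int)
  qed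
  ultimately show ?thesis by (intro labellingI)
qed

text \<open>If each chosen point has less than half the \<gamma>-value of its predecessor, the
  intervals from 3/4 to 3/2 of these values are disjoint. Their preimages under \<gamma> are the
  sets \<open>B k\<close>.\<close>

lemma shells:
  fixes \<gamma> :: "'a::topological_space \<Rightarrow> real" and X :: "nat \<Rightarrow> 'a set"
  assumes cont: "continuous_on UNIV \<gamma>"
    and small: "\<And>k e. e > 0 \<Longrightarrow> \<exists>x\<in>X k. 0 < \<gamma> x \<and> \<gamma> x < e"
  obtains x B where "\<And>k. x k \<in> X k" "\<And>k. x k \<in> B k" "\<And>k. open (B k)" "disjoint_family B"
    "\<And>k y. y \<in> B k \<Longrightarrow> 0 < \<gamma> y \<and> \<gamma> y < 1 / Suc k"
proof -
  \<comment> \<open>The factor 2 leaves room for the upper end \<open>3/2 * \<gamma> (x k)\<close>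
    of the shell below \<open>1 / Suc k\<close>.\<close>
  define P where "P k x \<longleftrightarrow> x \<in> X k \<and> 0 < \<gamma> x \<and> \<gamma> x < 1 / (2 * Suc k)" for k x
  have "\<exists>f. \<forall>n. P n (f n) \<and> \<gamma> (f (Suc n)) < \<gamma> (f n) / 2"
  proof (rule dependent_nat_choice)
    show "\<exists>x. P 0 x" using small[of "1/2" 0] by (auto simp: P_def)
    fix x n assume "P n x"
    then have "min (\<gamma> x / 2) (1 / (2 * Suc (Suc n))) > 0" by (simp add: P_def)
    from small[OF this, of "Suc n"] show "\<exists>y. P (Suc n) y \<and> \<gamma> y < \<gamma> x / 2"
      by (auto simp: P_def)
  qed
  then obtain x where x: "\<And>n. P n (x n)" "\<And>n. \<gamma> (x (Suc n)) < \<gamma> (x n) / 2" by blast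
  have pos: "0 < \<gamma> (x n)" for n using x(1) by (auto simp: P_def)
  have dec: "\<gamma> (x k) < \<gamma> (x j) / 2" if "j < k" for j k
    using that
  proof (induction k)
    case (Suc k)
    then show ?case using x(2)[of k] pos[of k] by (cases "j = k") auto
  qed simp
  define B where "B k = {y. 3/4 * \<gamma> (x k) < \<gamma> y} \<inter> {y. \<gamma> y < 3/2 * \<gamma> (x k)}" for k
  have "open (B k)" for k
    unfolding B_def by (intro open_Int open_Collect_less cont continuous_intros)
  moreover have "B j \<inter> B k = {}" if "j < k" for j k
    using dec[OF that] by (auto simp: B_def)
  then have "disjoint_family B"
    unfolding disjoint_family_on_def by (metis Int_commute linorder_neqE_nat)
  moreover have "0 < \<gamma> y \<and> \<gamma> y < 1 / Suc k" if "y \<in> B k" for k y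
  proof -
    define c where "c = 1 / real (Suc k)"
    have "\<gamma> (x k) < c / 2" "c > 0" using x(1)[of k] by (auto simp: P_def c_def mult.commute)
    moreover have "3/4 * \<gamma> (x k) < \<gamma> y" "\<gamma> y < 3/2 * \<gamma> (x k)" using that by (auto simp: B_def)
    ultimately have "0 < \<gamma> y \<and> \<gamma> y < c" using pos[of k] by linarith
    then show ?thesis by (simp add: c_def)
  qed
  moreover have "x k \<in> X k" "x k \<in> B k" for k
    using x(1)[of k] by (auto simp: B_def P_def)
  ultimately show ?thesis using that by blast
qed

section \<open>Truncation of points of Cantor space, and positive sets\<close>

definition res :: "nat \<Rightarrow> (nat \<Rightarrow> bool) \<Rightarrow> bool list" where
  "res n \<alpha> = map \<alpha> [0..<n]"

lemma length_res [simp]: "length (res n \<alpha>) = n"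
  by (simp add: res_def)

lemma res_eq_iff: "res n \<alpha> = res n \<beta> \<longleftrightarrow> (\<forall>i<n. \<alpha> i = \<beta> i)"
  by (auto simp: res_def)

lemma eventually_inj_on_res:
  assumes "finite A"
  shows "\<forall>\<^sub>F n in sequentially. inj_on (res n) A"
proof -
  have "\<forall>\<^sub>F n in sequentially. \<alpha> \<noteq> \<beta> \<longrightarrow> res n \<alpha> \<noteq> res n \<beta>" for \<alpha> \<beta>
  proof (cases "\<alpha> = \<beta>")
    case False
    then obtain i where "\<alpha> i \<noteq> \<beta> i" by auto
    then have ne: "res n \<alpha> \<noteq> res n \<beta>" if "i < n" for n
      using that res_eq_iff[of n \<alpha> \<beta>] by blast
    show ?thesis
      using eventually_gt_at_top[of i] by eventually_elim (simp add: ne)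
  qed simp
  then have "\<forall>\<^sub>F n in sequentially. \<forall>\<alpha>\<in>A. \<forall>\<beta>\<in>A. \<alpha> \<noteq> \<beta> \<longrightarrow> res n \<alpha> \<noteq> res n \<beta>"
    using assms by (simp add: eventually_ball_finite_distrib)
  then show ?thesis
    by eventually_elim (auto simp: inj_on_def)
qed

lemma res_in_labels: "finite G \<Longrightarrow> \<alpha> \<in> G \<Longrightarrow> (res n \<alpha>, res n ` G) \<in> labels"
  by (auto simp: labels_def)

definition positive_at ::
  "('a \<Rightarrow> label option) \<Rightarrow> (nat \<Rightarrow> bool) \<Rightarrow> 'a set \<Rightarrow> bool" where
  "positive_at lam \<alpha> S \<longleftrightarrow> (\<forall>F. finite F \<and> \<alpha> \<in> F \<longrightarrow>
     (\<exists>G. finite G \<and> F \<subseteq> G \<and>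
       (\<exists>\<^sub>F n in sequentially. \<exists>x\<in>S. lam x = Some (res n \<alpha>, res n ` G))))"

lemma positiveD:
  assumes "positive_at lam \<alpha> S" "finite F" "\<alpha> \<in> F"
  obtains G where "finite G" "F \<subseteq> G"
    "\<exists>\<^sub>F n in sequentially. \<exists>x\<in>S. lam x = Some (res n \<alpha>, res n ` G)"
  using assms unfolding positive_at_def by blast

lemma positive_mono:
  assumes "positive_at lam \<alpha> S" "\<And>x n G. x \<in> S \<Longrightarrow> lam x = Some (res n \<alpha>, G) \<Longrightarrow> x \<in> T"
  shows "positive_at lam \<alpha> T"
  unfolding positive_at_def
proof (intro allI impI, elim conjE)
  fix F assume "finite F" "\<alpha> \<in> F"
  then obtain G where G: "finite G" "F \<subseteq> G"
    "\<exists>\<^sub>F n in sequentially. \<exists>x\<in>S. lam x = Some (res n \<alpha>, res n ` G)"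
    using assms(1) positiveD by blast
  have "\<exists>\<^sub>F n in sequentially. \<exists>x\<in>T. lam x = Some (res n \<alpha>, res n ` G)"
    using G(3) by (rule frequently_elim1) (use assms(2) in blast)
  with G show "\<exists>G. finite G \<and> F \<subseteq> G \<and>
       (\<exists>\<^sub>F n in sequentially. \<exists>x\<in>T. lam x = Some (res n \<alpha>, res n ` G))" by blast
qed

text \<open>If \<open>F1\<close> and \<open>F2\<close> witness the failure for \<open>S\<close> and
  for \<open>T\<close>, then \<open>F1 \<union> F2\<close> witnesses it for the union: a larger
  \<open>G\<close> contains both, and "for infinitely many n" distributes over disjunction. So the
  sets that are not positive at a fixed \<alpha> form an ideal.\<close>

lemma positive_UnD:
  assumes "positive_at lam \<alpha> (S \<union> T)"
  shows "positive_at lam \<alpha> S \<or> positive_at lam \<alpha> T"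
proof (rule ccontr)
  let ?P = "\<lambda>S G. \<exists>\<^sub>F n in sequentially. \<exists>x\<in>S. lam x = Some (res n \<alpha>, res n ` G)"
  assume "\<not> ?thesis"
  then have neg: "\<not> positive_at lam \<alpha> S" "\<not> positive_at lam \<alpha> T" by auto
  obtain F1 where F1: "finite F1" "\<alpha> \<in> F1" "\<not> (\<exists>G. finite G \<and> F1 \<subseteq> G \<and> ?P S G)"
    using neg(1) unfolding positive_at_def by (auto simp only: not_all not_imp)
  obtain F2 where F2: "finite F2" "\<alpha> \<in> F2" "\<not> (\<exists>G. finite G \<and> F2 \<subseteq> G \<and> ?P T G)"
    using neg(2) unfolding positive_at_def by (auto simp only: not_all not_imp)
  obtain G where G: "finite G" "F1 \<union> F2 \<subseteq> G"
    "\<exists>\<^sub>F n in sequentially. \<exists>x\<in>S\<union>T. lam x = Some (res n \<alpha>, res n ` G)"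
    using positiveD[OF assms, of "F1 \<union> F2"] F1(1,2) F2(1) by auto
  then have "\<not> ?P S G" "\<not> ?P T G" using F1(3) F2(3) by (meson le_sup_iff)+
  with G(3) show False by (simp add: bex_Un frequently_disj_iff)
qed

lemma positive_of_infinite:
  assumes lam: "labelling lam" and U: "open U" and inf: "infinite {\<beta>. positive_at lam \<beta> U}"
  shows "positive_at lam \<alpha> U"
  unfolding positive_at_def
proof (intro allI impI, elim conjE)
  fix F assume F: "finite F" "\<alpha> \<in> F"
  obtain \<beta> where \<beta>: "\<beta> \<notin> F" "positive_at lam \<beta> U"
    using inf F(1) by (metis finite_subset mem_Collect_eq subsetI)
  then obtain G where G: "finite G" "insert \<beta> F \<subseteq> G"
    and fr: "\<exists>\<^sub>F n in sequentially. \<exists>x\<in>U. lam x = Some (res n \<beta>, res n ` G)"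
    using positiveD[of lam \<beta> U "insert \<beta> F"] F by auto
  have "\<exists>\<^sub>F n in sequentially. \<exists>x\<in>U. lam x = Some (res n \<alpha>, res n ` F)"
    using frequently_eventually_frequently[OF fr eventually_inj_on_res[OF G(1)]]
  proof (rule frequently_elim1, elim conjE bexE)
    fix n x assume inj: "inj_on (res n) G" and x: "x \<in> U" "lam x = Some (res n \<beta>, res n ` G)"
    \<comment> \<open>Although \<beta> is outside \<open>F\<close>, its truncation avoids those of
      \<open>F\<close> only when \<open>res n\<close> is injective on \<open>G\<close>. This holds
      for all large \<open>n\<close>, so infinitely many of the given \<open>n\<close>
      remain.\<close>
    have "res n \<beta> \<notin> res n ` F"
      using inj_on_image_mem_iff[OF inj, of \<beta> F] \<beta> G by auto
    then have "below (res n \<alpha>, res n ` F) (res n \<beta>, res n ` G)"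
      using image_mono[of F G "res n"] G(2) unfolding below_def by (simp add: subset_Diff_insert)
    then have "x \<in> closure {z. lam z = Some (res n \<alpha>, res n ` F)}"
      using labelling_closure[OF lam x(2)] res_in_labels[OF F] by blast
    then show "\<exists>x\<in>U. lam x = Some (res n \<alpha>, res n ` F)"
      using x U by (auto simp: closure_iff_nhds_not_empty)
  qed
  with F show "\<exists>G. finite G \<and> F \<subseteq> G \<and>
       (\<exists>\<^sub>F n in sequentially. \<exists>x\<in>U. lam x = Some (res n \<alpha>, res n ` G))" by blast
qed

lemma positive_UNIV:
  assumes "labels \<subseteq> ran lam"
  shows "positive_at lam \<alpha> UNIV"
  unfolding positive_at_def
proof (intro allI impI, elim conjE)
  fix F :: "(nat \<Rightarrow> bool) set" assume F: "finite F" "\<alpha> \<in> F"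
  have "\<exists>x. lam x = Some (res n \<alpha>, res n ` F)" for n
    using assms res_in_labels[OF F] by (fastforce simp: ran_def)
  with F show "\<exists>G. finite G \<and> F \<subseteq> G \<and>
       (\<exists>\<^sub>F n in sequentially. \<exists>x\<in>UNIV. lam x = Some (res n \<alpha>, res n ` G))"
    by (intro exI[of _ F]) auto
qed

text \<open>The union of the neighbourhoods belonging to the points labelled with truncations of
  \<alpha> works: any further label in it has a finite set without that truncation, whereas
  positivity at \<beta> supplies labels whose set \<open>G\<close> contains \<alpha>.\<close>

lemma separating_open_set:
  assumes lam: "labelling lam"
  obtains U where "open U" "\<And>x n G. lam x = Some (res n \<alpha>, G) \<Longrightarrow> x \<in> U"
    "\<And>\<beta>. \<beta> \<noteq> \<alpha> \<Longrightarrow> \<not> positive_at lam \<beta> U"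
proof -
  define Y where "Y = {y. \<exists>n G. lam y = Some (res n \<alpha>, G)}"
  have "\<exists>N. open N \<and> y \<in> N \<and> (\<forall>z\<in>N. \<forall>l'. lam z = Some l' \<longrightarrow> l' = the (lam y) \<or> below l' (the (lam y)))"
    if "y \<in> Y" for y
    using that labelling_nbhd[OF lam, of y] unfolding Y_def by (smt (verit) mem_Collect_eq option.sel)
  then obtain N where N: "\<And>y. y \<in> Y \<Longrightarrow> open (N y)" "\<And>y. y \<in> Y \<Longrightarrow> y \<in> N y"
    "\<And>y z l'. y \<in> Y \<Longrightarrow> z \<in> N y \<Longrightarrow> lam z = Some l' \<Longrightarrow> l' = the (lam y) \<or> below l' (the (lam y))"
    by metis
  have "\<not> positive_at lam \<beta> (\<Union>y\<in>Y. N y)" if "\<beta> \<noteq> \<alpha>" for \<beta>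
  proof
    assume "positive_at lam \<beta> (\<Union>y\<in>Y. N y)"
    then obtain G where G: "finite G" "{\<alpha>, \<beta>} \<subseteq> G"
      and fr: "\<exists>\<^sub>F n in sequentially. \<exists>x\<in>\<Union>y\<in>Y. N y. lam x = Some (res n \<beta>, res n ` G)"
      by (rule positiveD[of _ _ _ "{\<alpha>, \<beta>}"]) auto
    from frequently_eventually_frequently[OF fr eventually_inj_on_res[OF G(1)]]
    obtain n x y where inj: "inj_on (res n) G" and y: "y \<in> Y" and x: "x \<in> N y"
      "lam x = Some (res n \<beta>, res n ` G)"
      using frequently_ex by (smt (verit) UN_E)
    obtain m G' where l: "lam y = Some (res m \<alpha>, G')" using y by (auto simp: Y_def)
    have ne: "res n \<beta> \<noteq> res n \<alpha>" using inj G that by (auto dest: inj_onD)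
    from N(3)[OF y x] l consider "(res n \<beta>, res n ` G) = (res m \<alpha>, G')"
      | "below (res n \<beta>, res n ` G) (res m \<alpha>, G')" by auto
    then show False
    proof cases
      case 1
      then have "n = m" by (metis Pair_inject length_res)
      with 1 ne show False by simp
    next
      case 2
      \<comment> \<open>All members of \<open>G'\<close> have length \<open>m\<close>, so
        \<open>res n \<alpha>\<close> could belong to it only for \<open>n = m\<close>, where it is
        the removed element.\<close>
      then have *: "res n \<alpha> \<in> G'" "res n \<alpha> \<noteq> res m \<alpha>" using G by (auto simp: below_def)
      have "\<forall>t\<in>G'. length t = m" using labelling_in_labels[OF lam l] by (auto simp: labels_def)
      with * show False by force
    qed
  qed
  moreover have "open (\<Union>y\<in>Y. N y)" using N(1) by auto
  moreover have "x \<in> (\<Union>y\<in>Y. N y)" if "lam x = Some (res n \<alpha>, G)" for x n G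
    using that N(2) by (auto simp: Y_def)
  ultimately show ?thesis using that by blast
qed

section \<open>Maximal filters of open sets\<close>

definition open_filter :: "'a::topological_space set set \<Rightarrow> bool" where
  "open_filter F \<longleftrightarrow> F \<subseteq> Collect open \<and> UNIV \<in> F \<and> (\<forall>U\<in>F. \<forall>V\<in>F. U \<inter> V \<in> F) \<and>
     (\<forall>U\<in>F. \<forall>V. open V \<and> U \<subseteq> V \<longrightarrow> V \<in> F)"

lemma open_filterI:
  assumes "\<And>U. U \<in> F \<Longrightarrow> open U" "UNIV \<in> F" "\<And>U V. U \<in> F \<Longrightarrow> V \<in> F \<Longrightarrow> U \<inter> V \<in> F"
    and "\<And>U V. U \<in> F \<Longrightarrow> open V \<Longrightarrow> U \<subseteq> V \<Longrightarrow> V \<in> F"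
  shows "open_filter F"
  unfolding open_filter_def
proof (intro conjI ballI allI impI)
  show "F \<subseteq> Collect open" using assms(1) by auto
  show "V \<in> F" if "U \<in> F" "open V \<and> U \<subseteq> V" for U V using assms(4) that by blast
qed (rule assms(2,3); assumption?)+

lemma open_filterD:
  assumes "open_filter F"
  shows "U \<in> F \<Longrightarrow> open U" "UNIV \<in> F" "U \<in> F \<Longrightarrow> V \<in> F \<Longrightarrow> U \<inter> V \<in> F"
    "U \<in> F \<Longrightarrow> open V \<Longrightarrow> U \<subseteq> V \<Longrightarrow> V \<in> F"
proof -
  note F = assms[unfolded open_filter_def]
  show "U \<in> F \<Longrightarrow> open U" using conjunct1[OF F] by auto
  show "UNIV \<in> F" using F by (elim conjE)
  show "U \<in> F \<Longrightarrow> V \<in> F \<Longrightarrow> U \<inter> V \<in> F" using F[THEN conjunct2, THEN conjunct2, THEN conjunct1] by blast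
  show "U \<in> F \<Longrightarrow> open V \<Longrightarrow> U \<subseteq> V \<Longrightarrow> V \<in> F" using F[THEN conjunct2, THEN conjunct2, THEN conjunct2] by blast
qed

text \<open>Zorn's lemma gives a maximal \<open>F\<close>. If \<open>U\<close> meets no member of
  \<open>F\<close> in a set of \<open>I\<close>, the filter generated by \<open>F\<close> and
  \<open>U\<close> still avoids \<open>I\<close>, hence equals \<open>F\<close> and contains
  \<open>U\<close>. Closure of \<open>I\<close> under subsets is enough for this, so
  \<open>I\<close> may consist of the sets that fail to be positive at some \<alpha>, which need not
  be closed under unions.\<close>

lemma maximal_open_filter:
  fixes F0 :: "'a::topological_space set set"
  assumes F0: "open_filter F0" "F0 \<inter> I = {}"
    and I: "\<And>A B. A \<in> I \<Longrightarrow> B \<subseteq> A \<Longrightarrow> B \<in> I"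
  obtains F where "open_filter F" "F0 \<subseteq> F" "F \<inter> I = {}"
    "\<And>U. open U \<Longrightarrow> U \<notin> F \<Longrightarrow> \<exists>V\<in>F. U \<inter> V \<in> I"
proof -
  define \<A> where "\<A> = {F. open_filter F \<and> F0 \<subseteq> F \<and> F \<inter> I = {}}"
  have "\<exists>M\<in>\<A>. \<forall>X\<in>\<A>. M \<subseteq> X \<longrightarrow> X = M"
  proof (rule subset_Zorn_nonempty)
    show "\<A> \<noteq> {}" using F0 by (auto simp: \<A>_def)
    fix C assume C: "C \<noteq> {}" "subset.chain \<A> C"
    then have CA: "F \<in> \<A>" if "F \<in> C" for F using that by (auto simp: subset.chain_def)
    have "U \<inter> V \<in> \<Union>C" if "U \<in> \<Union>C" "V \<in> \<Union>C" for U V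
    proof -
      from that obtain F G where "F \<in> C" "G \<in> C" "U \<in> F" "V \<in> G" by auto
      moreover have "F \<subseteq> G \<or> G \<subseteq> F"
        using C(2) \<open>F \<in> C\<close> \<open>G \<in> C\<close> by (auto simp: subset_chain_def)
      ultimately obtain H where "H \<in> C" "U \<in> H" "V \<in> H" by blast
      moreover from this have "open_filter H" using CA by (simp add: \<A>_def)
      ultimately show ?thesis using open_filterD(3) by blast
    qed
    moreover have filt: "open_filter F" "F0 \<subseteq> F" "F \<inter> I = {}" if "F \<in> C" for F
      using CA[OF that] by (auto simp: \<A>_def)
    moreover have "open U" if "U \<in> \<Union>C" for U
      using that open_filterD(1)[OF filt(1)] by blast
    moreover have "UNIV \<in> \<Union>C" using C(1) open_filterD(2)[OF filt(1)] by blast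
    moreover have "V \<in> \<Union>C" if "U \<in> \<Union>C" "open V" "U \<subseteq> V" for U V
      using that open_filterD(4)[OF filt(1)] by blast
    ultimately have "open_filter (\<Union>C)" by (intro open_filterI)
    moreover have "F0 \<subseteq> \<Union>C" using C(1) filt(2) by blast
    moreover have "\<Union>C \<inter> I = {}" using filt(3) by blast
    ultimately show "\<Union>C \<in> \<A>" by (simp add: \<A>_def)
  qed
  then obtain F where "F \<in> \<A>" and max: "\<And>X. X \<in> \<A> \<Longrightarrow> F \<subseteq> X \<Longrightarrow> X = F"
    by blast
  then have F: "open_filter F" "F0 \<subseteq> F" "F \<inter> I = {}" by (auto simp: \<A>_def)
  have "\<exists>V\<in>F. U \<inter> V \<in> I" if U: "open U" "U \<notin> F" for U
  proof (rule ccontr)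
    assume no: "\<not> ?thesis"
    define X where "X = {W. open W \<and> (\<exists>V\<in>F. U \<inter> V \<subseteq> W)}"
    have "open_filter X"
    proof (rule open_filterI)
      show "UNIV \<in> X" using open_filterD(2)[OF F(1)] by (auto simp: X_def)
      fix W W' assume "W \<in> X" "W' \<in> X"
      then obtain V V' where V: "open W" "open W'" "V \<in> F" "V' \<in> F"
        "U \<inter> V \<subseteq> W" "U \<inter> V' \<subseteq> W'" by (auto simp: X_def)
      then have "V \<inter> V' \<in> F" "U \<inter> (V \<inter> V') \<subseteq> W \<inter> W'" using open_filterD(3)[OF F(1)] by auto
      then show "W \<inter> W' \<in> X" using V unfolding X_def by blast
    qed (auto simp: X_def)
    moreover have FX: "F \<subseteq> X"
      using open_filterD(1)[OF F(1)] by (auto simp: X_def)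
    moreover have "X \<inter> I = {}" using no I unfolding X_def by blast
    ultimately have "X = F" using max F(2) unfolding \<A>_def by blast
    moreover have "U \<in> X" using U open_filterD(2)[OF F(1)] by (auto simp: X_def)
    ultimately show False using U by simp
  qed
  with F that show ?thesis by blast
qed

subsection \<open>Labellings of locally compact metric spaces\<close>

text \<open>The topology belongs to the type and metrizability only provides some compatible metric,
  so the metric is a parameter.\<close>

locale locally_compact_metric =
  fixes d :: "'a::t2_space \<Rightarrow> 'a \<Rightarrow> real"
  assumes metric: "Metric_space UNIV d"
    and mtopology: "Metric_space.mtopology UNIV d = euclidean"
    and loc_compact: "locally_compact_space (euclidean :: 'a topology)"
begin

sublocale Metric_space UNIV d
  by (rule metric)

lemma open_iff: "open U \<longleftrightarrow> (\<forall>x\<in>U. \<exists>r>0. \<forall>y. d x y < r \<longrightarrow> y \<in> U)"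
proof -
  have "open U \<longleftrightarrow> openin (Metric_space.mtopology UNIV d) U"
    by (simp add: mtopology)
  also have "\<dots> \<longleftrightarrow> (\<forall>x\<in>U. \<exists>r>0. \<forall>y. d x y < r \<longrightarrow> y \<in> U)"
    by (auto simp: openin_mtopology mball_def subset_iff)
  finally show ?thesis .
qed

lemma open_dist_ball: "open {y. d x y < r}"
  unfolding open_iff
proof (intro ballI)
  fix y assume y: "y \<in> {y. d x y < r}"
  have "z \<in> {y. d x y < r}" if "d y z < r - d x y" for z
    using triangle[of x y z] that by simp
  then show "\<exists>e>0. \<forall>z. d y z < e \<longrightarrow> z \<in> {y. d x y < r}"
    using y by (intro exI[of _ "r - d x y"]) auto
qed

lemma continuous_on_Lipschitz:
  fixes f :: "'a \<Rightarrow> real"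
  assumes "\<And>y z. \<bar>f y - f z\<bar> \<le> d y z"
  shows "continuous_on UNIV f"
proof -
  have "open (f -` B)" if "open B" for B
    unfolding open_iff
  proof
    fix y assume "y \<in> f -` B"
    then have "\<exists>e>0. \<forall>t. \<bar>t - f y\<bar> < e \<longrightarrow> t \<in> B"
      using that by (simp add: open_dist dist_real_def)
    then obtain e where e: "e > 0" "\<And>t. \<bar>t - f y\<bar> < e \<Longrightarrow> t \<in> B" by blast
    have "z \<in> f -` B" if "d y z < e" for z
      using e(2)[of "f z"] assms[of y z] that by auto
    then show "\<exists>r>0. \<forall>z. d y z < r \<longrightarrow> z \<in> f -` B" using e(1) by blast
  qed
  then show ?thesis by (simp add: continuous_on_open_vimage)
qed

lemma dist_Lipschitz: "\<bar>d x y - d x z\<bar> \<le> d y z"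
  using triangle[of x y z] triangle[of x z y] commute[of y z] by simp

lemma continuous_on_metric: "continuous_on UNIV (d x)"
  by (intro continuous_on_Lipschitz dist_Lipschitz)

lemma in_closure_iff: "y \<in> closure S \<longleftrightarrow> (\<forall>r>0. \<exists>z\<in>S. d y z < r)"
proof
  assume y: "y \<in> closure S"
  show "\<forall>r>0. \<exists>z\<in>S. d y z < r"
  proof (intro allI impI)
    fix r :: real assume "r > 0"
    then have "y \<in> {z. d y z < r} \<inter> closure S" using y by simp
    then have "{z. d y z < r} \<inter> S \<noteq> {}" using open_Int_closure_eq_empty[OF open_dist_ball] by blast
    then show "\<exists>z\<in>S. d y z < r" by blast
  qed
next
  assume S: "\<forall>r>0. \<exists>z\<in>S. d y z < r"
  show "y \<in> closure S"
  proof (rule ccontr)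
    assume "y \<notin> closure S"
    moreover have "open (- closure S)" by (simp add: open_Compl)
    ultimately obtain r where "r > 0" "\<And>z. d y z < r \<Longrightarrow> z \<notin> closure S"
      unfolding open_iff by blast
    with S closure_subset[of S] show False by blast
  qed
qed

definition set_dist :: "'a set \<Rightarrow> 'a \<Rightarrow> real" where
  "set_dist C y = (INF c\<in>C. d y c)"

context
  fixes C :: "'a set"
  assumes C: "C \<noteq> {}"
begin

lemma bdd_below_dist: "bdd_below (d y ` C)"
  by (rule bdd_belowI[of _ 0]) auto

lemma set_dist_less_iff: "set_dist C y < r \<longleftrightarrow> (\<exists>c\<in>C. d y c < r)"
  unfolding set_dist_def by (intro cINF_less_iff C bdd_below_dist)

lemma set_dist_nonneg: "0 \<le> set_dist C y"
  unfolding set_dist_def by (intro cINF_greatest C) auto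

lemma set_dist_eq_0_iff: "set_dist C y = 0 \<longleftrightarrow> y \<in> closure C"
proof -
  have "set_dist C y = 0 \<longleftrightarrow> (\<forall>r>0. set_dist C y < r)"
    using set_dist_nonneg[of y] by (metis less_eq_real_def less_irrefl)
  then show ?thesis by (simp add: in_closure_iff set_dist_less_iff)
qed

lemma continuous_on_set_dist: "continuous_on UNIV (set_dist C)"
proof (rule continuous_on_Lipschitz)
  have *: "set_dist C y \<le> d y z + set_dist C z" for y z
  proof (rule field_le_epsilon)
    fix e :: real assume "e > 0"
    then obtain c where "c \<in> C" "d z c < set_dist C z + e"
      using set_dist_less_iff[of z "set_dist C z + e"] by auto
    moreover have "set_dist C y \<le> d y c"
      unfolding set_dist_def using \<open>c \<in> C\<close> by (intro cINF_lower bdd_below_dist)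
    ultimately show "set_dist C y \<le> d y z + set_dist C z + e"
      using triangle[of y z c] by simp
  qed
  show "\<bar>set_dist C y - set_dist C z\<bar> \<le> d y z" for y z
    using *[of y z] *[of z y] commute[of y z] by simp
qed

end

lemma closed_zero_set:
  assumes "closed C"
  obtains f :: "'a \<Rightarrow> real" where "continuous_on UNIV f" "\<And>x. f x = 0 \<longleftrightarrow> x \<in> C"
proof (cases "C = {}")
  case True
  then show ?thesis using that[of "\<lambda>_. 1"] by simp
next
  case False
  then show ?thesis
    using that[OF continuous_on_set_dist[OF False]] set_dist_eq_0_iff[OF False] assms by simp
qed

text \<open>Induction on \<open>m\<close>, with \<open>D m\<close> in the role of the m-th derived
  set. A lower label has a smaller finite set, so it can be placed at a point of the preceding set,
  and such points converge to \<open>x\<close>. Labellings of disjoint neighbourhoods of these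
  points are glued and \<open>x\<close> is added.\<close>

lemma labelling_at:
  fixes D :: "nat \<Rightarrow> 'a set"
  assumes D: "\<And>m x. x \<in> D (Suc m) \<Longrightarrow> x islimpt D m"
  shows "x \<in> D m \<Longrightarrow> l \<in> labels \<Longrightarrow> card (snd l) \<le> Suc m \<Longrightarrow> open W \<Longrightarrow> x \<in> W \<Longrightarrow>
    \<exists>lam. labelling lam \<and> dom lam \<subseteq> W \<and> lam x = Some l \<and>
      (\<forall>y l'. lam y = Some l' \<longrightarrow> l' = l \<or> below l' l)"
proof (induction m arbitrary: x l W rule: less_induct)
  case (less m)
  note x = less.prems(1) and l = less.prems(2) and W = less.prems(4,5)
  define Lw where "Lw = {l' \<in> labels. below l' l}"
  have finl: "finite (snd l)" "fst l \<in> snd l" using l by (auto simp: labels_def)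
  have card_below: "0 < card (snd l') \<and> card (snd l') < card (snd l)" if "l' \<in> Lw" for l'
  proof -
    have "snd l' \<noteq> {}" "finite (snd l')" using that by (auto simp: Lw_def labels_def)
    moreover have "snd l' \<subset> snd l" using that finl by (auto simp: Lw_def below_def)
    ultimately show ?thesis using finl psubset_card_mono by (auto simp: card_gt_0_iff)
  qed
  show ?case
  proof (cases "Lw = {}")
    case True
    \<comment> \<open>Nothing lies below \<open>l\<close>, so one labelled point suffices.\<close>
    define lam where "lam = (\<lambda>y. if y = x then Some l else None)"
    have "labelling lam"
    proof (rule labellingI)
      have dom: "dom lam = {x}" by (auto simp: lam_def split: if_splits)
      show "countable (dom lam)" by (simp add: dom)
      show "ran lam \<subseteq> labels" using l by (auto simp: lam_def ran_def)
      show "y \<in> closure {z. lam z = Some l''}"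
        if "lam y = Some l'" "l'' \<in> labels" "below l'' l'" for y l' l''
      proof -
        have "l' = l" using that(1) by (auto simp: lam_def split: if_splits)
        then show ?thesis using that True unfolding Lw_def by blast
      qed
      show "\<exists>N. open N \<and> y \<in> N \<and> (\<forall>z\<in>N. \<forall>l''. lam z = Some l'' \<longrightarrow> l'' = l' \<or> below l'' l')"
        if "lam y = Some l'" for y l'
        using that by (intro exI[of _ UNIV]) (auto simp: lam_def split: if_splits)
    qed
    moreover have "dom lam \<subseteq> W" "lam x = Some l" "lam y = Some l' \<Longrightarrow> l' = l" for y l'
      using W by (auto simp: lam_def split: if_splits)
    ultimately show ?thesis by blast
  next
    case False
    \<comment> \<open>A lower label has a nonempty finite set smaller than \<open>snd l\<close>, so
      \<open>snd l\<close> has at least two elements.\<close>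
    have "m \<noteq> 0" using False card_below less.prems(3) by fastforce
    then obtain m' where m: "m = Suc m'" by (cases m) auto
    \<comment> \<open>Taking the first entry of the decoded pair repeats every lower label
      infinitely often, so each of them recurs in shells arbitrarily close to
      \<open>x\<close>.\<close>
    define e where "e k = from_nat_into Lw (fst (prod_decode k))" for k
    have e: "e k \<in> Lw" for k using False by (auto simp: e_def from_nat_into)
    have "\<exists>y\<in>D m' \<inter> W. 0 < d x y \<and> d x y < r" if "r > 0" for r
    proof -
      have "open (W \<inter> {y. d x y < r})" "x \<in> W \<inter> {y. d x y < r}"
        using W open_dist_ball that by auto
      moreover have "x islimpt D m'" using D x m by simp
      ultimately obtain y where "y \<in> D m'" "y \<in> W \<inter> {y. d x y < r}" "y \<noteq> x"
        by (meson islimptE)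
      then show ?thesis by (intro bexI[of _ y]) auto
    qed
    then obtain c B0 where c: "\<And>k. c k \<in> D m' \<inter> W" "\<And>k. c k \<in> B0 k"
      and B0: "\<And>k. open (B0 k)" "disjoint_family B0"
        "\<And>k y. y \<in> B0 k \<Longrightarrow> 0 < d x y \<and> d x y < 1 / Suc k"
      by (rule shells[OF continuous_on_metric, of "\<lambda>k. D m' \<inter> W" x]) auto
    define B where "B k = B0 k \<inter> W" for k
    have B: "open (B k)" "c k \<in> B k" for k
      using B0 W c by (auto simp: B_def)
    have disj: "disjoint_family B"
      using B0(2) by (auto simp: B_def disjoint_family_on_def)
    have "\<exists>lam. labelling lam \<and> dom lam \<subseteq> B k \<and> lam (c k) = Some (e k) \<and>
      (\<forall>y l'. lam y = Some l' \<longrightarrow> l' = e k \<or> below l' (e k))" for k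
    proof (rule less.IH[of m'])
      show "card (snd (e k)) \<le> Suc m'"
        using card_below[OF e[of k]] less.prems(3) m by simp
    qed (use c e B in \<open>auto simp: m Lw_def\<close>)
    then obtain L where L: "\<And>k. labelling (L k)" "\<And>k. dom (L k) \<subseteq> B k"
      "\<And>k. L k (c k) = Some (e k)"
      "\<And>k y l'. L k y = Some l' \<Longrightarrow> l' = e k \<or> below l' (e k)" by metis
    note g = labelling_glue[OF disj B(1) L(1,2)]
    note geq = glue_eq[OF disj, where L = L]
    have gB: "\<exists>k. y \<in> B k \<and> L k y = Some l'" if "glue B L y = Some l'" for y l'
      using that geq unfolding glue_def by (metis option.distinct(1))
    define lam where "lam y = (if y = x then Some l else glue B L y)" for y
    \<comment> \<open>The shells omit \<open>x\<close> because \<open>d x\<close> is positive on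
      them, so \<open>x\<close> is free to receive the label \<open>l\<close>.\<close>
    have "x \<notin> B k" for k using B0(3)[of x k] by (auto simp: B_def)
    then have gx: "glue B L x = None" by (auto simp: glue_def)
    have below_l: "l' = l \<or> below l' l" if "lam y = Some l'" for y l'
    proof (cases "y = x")
      case False
      then have "glue B L y = Some l'" using that by (simp add: lam_def)
      then obtain k where k: "L k y = Some l'" using gB by blast
      have "below (e k) l" using e[of k] by (simp add: Lw_def)
      then show ?thesis using L(4)[OF k] below_trans by blast
    qed (use that in \<open>auto simp: lam_def\<close>)
    have "labelling lam"
    proof (rule labellingI)
      have dom: "dom lam \<subseteq> insert x (dom (glue B L))" by (auto simp: lam_def split: if_splits)
      moreover have "countable (dom (glue B L))" using g by (simp add: labelling_def)
      ultimately show "countable (dom lam)" by (meson countable_insert countable_subset)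
      show "ran lam \<subseteq> labels"
        using l labelling_in_labels[OF g] by (auto simp: lam_def ran_def split: if_splits)
      show "y \<in> closure {z. lam z = Some l''}"
        if *: "lam y = Some l'" "l'' \<in> labels" "below l'' l'" for y l' l''
      proof (cases "y = x")
        case True
        then have l'': "l'' \<in> Lw" using * by (auto simp: lam_def Lw_def)
        show ?thesis
          unfolding in_closure_iff
        proof (intro allI impI)
          fix r :: real assume "r > 0"
          obtain i where i: "from_nat_into Lw i = l''"
            using l'' countable_labels from_nat_into_surj[of Lw l''] by (force simp: Lw_def)
          obtain j where j: "1 / real (Suc j) < r"
            using reals_Archimedean[OF \<open>r > 0\<close>] by (auto simp: inverse_eq_divide)
          \<comment> \<open>Here \<open>i\<close> selects the label and \<open>j\<close> the
            precision: the code \<open>k\<close> is at least \<open>j\<close>, so shell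
            \<open>k\<close> lies within \<open>1 / Suc j\<close> of \<open>x\<close>.\<close>
          define k where "k = prod_encode (i, j)"
          have "e k = l''" by (simp add: e_def k_def i)
          then have "glue B L (c k) = Some l''" using geq[of "c k" k] B L(3) by simp
          then have "lam (c k) = Some l''" using gx by (auto simp: lam_def)
          moreover have "j \<le> k" unfolding k_def by (rule le_prod_encode_2)
          then have "1 / real (Suc k) \<le> 1 / real (Suc j)" by (simp add: divide_simps)
          then have "d x (c k) < r" using B0(3)[OF c(2)[of k]] j by simp
          ultimately show "\<exists>z\<in>{z. lam z = Some l''}. d y z < r" using True by auto
        qed
      next
        case False
        then have "y \<in> closure {z. glue B L z = Some l''}"
          using labelling_closure[OF g] * by (simp add: lam_def)
        moreover have "{z. glue B L z = Some l''} \<subseteq> {z. lam z = Some l''}"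
          using gx by (auto simp: lam_def)
        ultimately show ?thesis using closure_mono by blast
      qed
      show "\<exists>N. open N \<and> y \<in> N \<and> (\<forall>z\<in>N. \<forall>l''. lam z = Some l'' \<longrightarrow> l'' = l' \<or> below l'' l')"
        if "lam y = Some l'" for y l'
      proof (cases "y = x")
        case True
        then have "l' = l" using that by (simp add: lam_def)
        then show ?thesis using below_l by (intro exI[of _ UNIV]) blast
      next
        case False
        then have "glue B L y = Some l'" using that by (simp add: lam_def)
        then obtain N where N: "open N" "y \<in> N"
          "\<And>z l''. z \<in> N \<Longrightarrow> glue B L z = Some l'' \<Longrightarrow> l'' = l' \<or> below l'' l'"
          using labelling_nbhd[OF g] by metis
        show ?thesis
        proof (intro exI[of _ "N - {x}"] conjI ballI allI impI)
          show "open (N - {x})" using N(1) by (rule open_delete)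
          show "y \<in> N - {x}" using N(2) False by simp
          fix z l'' assume "z \<in> N - {x}" "lam z = Some l''"
          then show "l'' = l' \<or> below l'' l'" using N(3)[of z l''] by (simp add: lam_def)
        qed
      qed
    qed
    moreover have "dom lam \<subseteq> W"
    proof
      fix y assume "y \<in> dom lam"
      then obtain l' where "lam y = Some l'" by auto
      then show "y \<in> W" using gB[of y] W by (auto simp: lam_def B_def split: if_splits)
    qed
    moreover have "lam x = Some l" by (simp add: lam_def)
    ultimately show ?thesis using below_l by blast
  qed
qed

text \<open>Each label gets its own shell and is the top label there. All labels in one shell have
  the same length, and a region where \<gamma> is bounded away from 0 meets only finitely many
  shells; this gives the last clause.\<close>

lemma labelling_along:
  fixes D :: "nat \<Rightarrow> 'a set" and \<gamma> :: "'a \<Rightarrow> real"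
  assumes D: "\<And>m x. x \<in> D (Suc m) \<Longrightarrow> x islimpt D m"
    and cont: "continuous_on UNIV \<gamma>"
    and small: "\<And>m e. e > 0 \<Longrightarrow> \<exists>x\<in>D m. 0 < \<gamma> x \<and> \<gamma> x < e"
  obtains lam where "labelling lam" "labels \<subseteq> ran lam"
    "\<And>e. e > 0 \<Longrightarrow> finite {length (fst l) | l x. e \<le> \<gamma> x \<and> lam x = Some l}"
proof -
  define e where "e = from_nat_into labels"
  have "([], {[]}) \<in> labels" by (simp add: labels_def)
  then have ne: "labels \<noteq> {}" by blast
  then have e: "e k \<in> labels" for k unfolding e_def by (rule from_nat_into)
  obtain c B where c: "\<And>k. c k \<in> D (card (snd (e k)))" "\<And>k. c k \<in> B k"
    and B: "\<And>k. open (B k)" "disjoint_family B"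
      "\<And>k y. y \<in> B k \<Longrightarrow> 0 < \<gamma> y \<and> \<gamma> y < 1 / Suc k"
    by (rule shells[OF cont, of "\<lambda>k. D (card (snd (e k)))"]) (use small in auto)
  have "\<exists>lam. labelling lam \<and> dom lam \<subseteq> B k \<and> lam (c k) = Some (e k) \<and>
      (\<forall>y l'. lam y = Some l' \<longrightarrow> l' = e k \<or> below l' (e k))" for k
    by (rule labelling_at[where D = D, OF D c(1) e le_SucI[OF order_refl] B(1) c(2)])
  then obtain L where L: "\<And>k. labelling (L k)" "\<And>k. dom (L k) \<subseteq> B k"
    "\<And>k. L k (c k) = Some (e k)"
    "\<And>k y l'. L k y = Some l' \<Longrightarrow> l' = e k \<or> below l' (e k)" by metis
  note g = labelling_glue[OF B(2,1) L(1,2)]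
  note geq = glue_eq[OF B(2), where L = L]
  have gB: "\<exists>k. y \<in> B k \<and> L k y = Some l'" if "glue B L y = Some l'" for y l'
    using that geq unfolding glue_def by (metis option.distinct(1))
  have "labels \<subseteq> ran (glue B L)"
  proof
    fix l assume "l \<in> labels"
    then obtain k where "e k = l"
      using countable_labels from_nat_into_surj[of labels l] by (auto simp: e_def)
    then have "glue B L (c k) = Some l" using geq[OF c(2)] L(3) by simp
    then show "l \<in> ran (glue B L)" by (rule ranI)
  qed
  moreover have "finite {length (fst l) | l x. r \<le> \<gamma> x \<and> glue B L x = Some l}" if "r > 0" for r
  proof -
    obtain K where K: "1 / real (Suc K) < r"
      using reals_Archimedean[OF \<open>r > 0\<close>] by (auto simp: inverse_eq_divide)
    have "length (fst l) \<in> (\<lambda>k. length (fst (e k))) ` {..K}"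
      if "r \<le> \<gamma> x" "glue B L x = Some l" for l x
    proof -
      obtain k where k: "x \<in> B k" "L k x = Some l" using gB \<open>glue B L x = Some l\<close> by blast
      have "1 / real (Suc K) < 1 / real (Suc k)" using B(3)[OF k(1)] that(1) K by linarith
      then have "k \<le> K" by (simp add: divide_simps)
      moreover have "length (fst l) = length (fst (e k))"
      proof -
        have "fst l \<in> snd l"
          by (rule labelsD(2)[OF labelling_in_labels[OF L(1) k(2)]])
        then have "l = e k \<or> fst l \<in> snd (e k)" using L(4)[OF k(2)] unfolding below_def by blast
        then show ?thesis using labelsD(3)[OF e[of k]] by blast
      qed
      ultimately show ?thesis by auto
    qed
    then have "{length (fst l) | l x. r \<le> \<gamma> x \<and> glue B L x = Some l}
        \<subseteq> (\<lambda>k. length (fst (e k))) ` {..K}" by blast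
    then show ?thesis by (rule finite_subset) simp
  qed
  ultimately show ?thesis using that g by blast
qed

section \<open>Nonnegative real functions vanishing at infinity, transferred later to either scalar
  field\<close>

definition vanishing :: "('a \<Rightarrow> real) \<Rightarrow> bool" where
  "vanishing g \<longleftrightarrow> continuous_on UNIV g \<and> (\<forall>x. 0 \<le> g x) \<and> (\<forall>e>0. compact {x. e \<le> g x})"

text \<open>The Weierstrass test gives continuity. For compactness, a partial sum uniformly within
  \<open>e / 2\<close> of \<open>g\<close> shows that \<open>g x \<ge> e\<close> forces one of
  finitely many terms to be at least \<open>r\<close>, so the set in question is closed inside a
  finite union of compact sets.\<close>

lemma vanishing_suminf:
  fixes h :: "nat \<Rightarrow> 'a \<Rightarrow> real"
  assumes h: "\<And>k. vanishing (h k)" "\<And>k x. h k x \<le> (1/2) ^ k"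
  obtains g where "vanishing g" "\<And>x k. h k x > 0 \<Longrightarrow> g x > 0"
proof -
  define g where "g x = (\<Sum>k. h k x)" for x
  have h0: "0 \<le> h k x" for k x using h(1) by (auto simp: vanishing_def)
  have geo: "summable (\<lambda>k. (1/2::real) ^ k)" by (rule summable_geometric) simp
  have lim: "uniform_limit UNIV (\<lambda>n x. \<Sum>k<n. h k x) g sequentially"
    unfolding g_def using h(2) h0 by (intro Weierstrass_m_test[OF _ geo]) auto
  have cont: "continuous_on UNIV g"
    by (rule uniform_limit_theorem[OF _ lim])
       (use h(1) in \<open>auto simp: vanishing_def intro!: always_eventually continuous_on_sum\<close>)
  have sum: "summable (\<lambda>k. h k x)" for x
    by (rule summable_comparison_test'[OF geo, of 0]) (use h(2) h0 in auto)
  have "compact {x. e \<le> g x}" if "e > 0" for e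
  proof -
    have "\<exists>N. \<forall>n\<ge>N. \<forall>x. \<bar>(\<Sum>k<n. h k x) - g x\<bar> < e / 2"
      using uniform_limitD[OF lim, of "e/2"] that
      by (simp add: eventually_sequentially dist_real_def)
    then obtain K where K: "\<And>x. \<bar>(\<Sum>k<K. h k x) - g x\<bar> < e / 2" by blast
    \<comment> \<open>The summand 1 makes \<open>K\<close> terms below \<open>r\<close> add up to
      strictly less than \<open>e / 2\<close> and covers \<open>K = 0\<close>.\<close>
    define r where "r = e / (2 * (real K + 1))"
    have r: "r > 0" "real K * r < e / 2" using that by (auto simp: r_def field_simps)
    have "\<exists>k<K. r \<le> h k x" if "e \<le> g x" for x
    proof (rule ccontr)
      assume "\<not> ?thesis"
      then have "(\<Sum>k<K. h k x) \<le> (\<Sum>k<K. r)" by (intro sum_mono) auto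
      also have "\<dots> < e / 2" using r(2) by simp
      finally show False using K[of x] that by linarith
    qed
    then have eq: "{x. e \<le> g x} = (\<Union>k<K. {x. r \<le> h k x}) \<inter> {x. e \<le> g x}" by auto
    have "compact (\<Union>k<K. {x. r \<le> h k x})"
      using h(1) r(1) by (intro compact_UN) (auto simp: vanishing_def)
    moreover have "closed {x. e \<le> g x}"
      by (intro closed_Collect_le cont continuous_on_const)
    ultimately show ?thesis by (subst eq) (rule compact_Int_closed)
  qed
  then have "vanishing g"
    using cont h0 sum by (auto simp: vanishing_def g_def suminf_nonneg)
  moreover have "g x > 0" if "h k x > 0" for x k
    unfolding g_def using suminf_pos_iff[OF sum h0] that by blast
  ultimately show ?thesis using that by blast
qed

text \<open>Sum up cone-shaped bumps around the points of \<open>A\<close>, of radius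
  \<open>1 / Suc j\<close> whenever that ball lies in a compact set, cut off at
  \<open>(1/2) ^ k\<close> for convergence. By local compactness every point of the closure lies in
  such a ball.\<close>

lemma vanishing_positive_on_closure:
  assumes "countable A"
  obtains g where "vanishing g" "\<And>x. x \<in> closure A \<Longrightarrow> g x > 0"
proof -
  define good where "good i j \<longleftrightarrow>
    (\<exists>C. compact C \<and> {y. d (from_nat_into A i) y < 1 / Suc j} \<subseteq> C)" for i j
  define h where "h i j y =
    (if good i j then max 0 (1 / Suc j - d (from_nat_into A i) y) else 0)" for i j y
  define h' where "h' k y = min ((1/2) ^ k) (h (fst (prod_decode k)) (snd (prod_decode k)) y)"
    for k y
  have conth: "continuous_on UNIV (h i j)" for i j
    unfolding h_def
    by (cases "good i j") (auto intro!: continuous_intros continuous_on_metric)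
  have cont: "continuous_on UNIV (h' k)" for k
    unfolding h'_def by (intro continuous_on_min continuous_on_const conth)
  have "compact {y. e \<le> h' k y}" if "e > 0" for e k
  proof -
    obtain i j where ij: "prod_decode k = (i, j)" by fastforce
    have cl: "closed {y. e \<le> h' k y}"
      by (intro closed_Collect_le cont continuous_on_const)
    show ?thesis
    proof (cases "good i j")
      case True
      then obtain C where C: "compact C" "{y. d (from_nat_into A i) y < 1 / Suc j} \<subseteq> C"
        by (auto simp: good_def)
      have "{y. e \<le> h' k y} \<subseteq> C"
        using that C(2) True by (auto simp: h'_def h_def ij subset_iff)
      then have "{y. e \<le> h' k y} = C \<inter> {y. e \<le> h' k y}" by auto
      then show ?thesis using compact_Int_closed[OF C(1) cl] by simp
    next
      case False
      then have "{y. e \<le> h' k y} = {}" using that by (auto simp: h'_def h_def ij)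
      then show ?thesis by simp
    qed
  qed
  then have "vanishing (h' k)" for k
    using cont by (auto simp: vanishing_def h'_def h_def)
  moreover have "h' k x \<le> (1/2) ^ k" for k x by (simp add: h'_def)
  ultimately obtain g where g: "vanishing g" "\<And>x k. h' k x > 0 \<Longrightarrow> g x > 0"
    using vanishing_suminf by blast
  have "g x > 0" if x: "x \<in> closure A" for x
  proof -
    obtain U C where UC: "open U" "compact C" "x \<in> U" "U \<subseteq> C"
      using loc_compact
      unfolding locally_compact_space_def topspace_euclidean open_openin[symmetric] compactin_euclidean_iff
      by blast
    then obtain r where r: "r > 0" "\<And>y. d x y < r \<Longrightarrow> y \<in> U" unfolding open_iff by blast
    \<comment> \<open>With half the radius, the ball about a point \<open>a\<close> this close to
      \<open>x\<close> stays in the ball of radius \<open>r\<close> about \<open>x\<close>, hence in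
      \<open>C\<close>.\<close>
    obtain j where j: "1 / real (Suc j) < r / 2"
      using reals_Archimedean[of "r / 2"] r(1) by (auto simp: inverse_eq_divide)
    obtain a where a: "a \<in> A" "d x a < 1 / Suc j"
      using x unfolding in_closure_iff by (meson of_nat_0_less_iff zero_less_Suc zero_less_divide_1_iff)
    obtain i where i: "from_nat_into A i = a"
      using from_nat_into_surj[OF assms a(1)] by blast
    have "y \<in> C" if "d a y < 1 / Suc j" for y
    proof -
      have "d x y < r" using triangle[of x a y] a(2) that j by simp
      then show ?thesis using r(2) UC(4) by blast
    qed
    then have "good i j" using UC(2) by (auto simp: good_def i)
    then have "h i j x > 0" using a(2) commute[of x a] by (simp add: h_def i)
    then have "h' (prod_encode (i, j)) x > 0" by (simp add: h'_def)
    then show ?thesis by (rule g(2))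
  qed
  with g(1) that show ?thesis by blast
qed

end

subsection \<open>Derived sets of the one-point compactification\<close>

text \<open>Limit points are taken in the space itself; these sets turn out to be the traces of the
  iterated derived sets of the compactification.\<close>

definition derived :: "nat \<Rightarrow> 'a::topological_space set" where
  "derived n = ((\<lambda>S. {x. x islimpt S}) ^^ n) UNIV"

lemma derived_Suc: "derived (Suc n) = {x. x islimpt derived n}"
  by (simp add: derived_def)

text \<open>If \<open>U\<close> is open and contains no point of \<open>S\<close> except possibly
  \<open>x\<close>, then no point of \<open>U\<close> is a limit point of \<open>S\<close>: for
  points other than \<open>x\<close> the open set \<open>U - {x}\<close> shows this.\<close>

lemma closed_islimpt: "closed {x :: 'a::t1_space. x islimpt S}"
  unfolding closed_def
proof (subst open_subopen, intro ballI)
  fix x assume "x \<in> - {x. x islimpt S}"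
  then obtain U where U: "x \<in> U" "open U" "\<And>y. y \<in> S \<Longrightarrow> y \<in> U \<Longrightarrow> y = x"
    unfolding islimpt_def by blast
  have "\<not> y islimpt S" if "y \<in> U" for y
  proof
    assume y: "y islimpt S"
    show False
    proof (cases "y = x")
      case True
      then obtain z where "z \<in> S" "z \<in> U" "z \<noteq> x" using y U(1,2) by (meson islimptE)
      then show False using U(3) by blast
    next
      case False
      then have "y \<in> U - {x}" "open (U - {x})" using \<open>y \<in> U\<close> U(2) by (auto intro: open_delete)
      then obtain z where "z \<in> S" "z \<in> U - {x}" using y by (meson islimptE)
      then show False using U(3) by blast
    qed
  qed
  with U show "\<exists>T. open T \<and> x \<in> T \<and> T \<subseteq> - {x. x islimpt S}" by blast
qed

lemma closed_derived: "closed (derived n :: 'a::t1_space set)"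
  by (cases n) (simp_all add: derived_def closed_islimpt)

abbreviation (input) one_point :: "'a::t2_space option topology" where
  "one_point \<equiv> Alexandroff_compactification euclidean"

lemma open_Some_vimage:
  assumes "openin one_point T"
  shows "open (Some -` T)"
proof -
  from assms consider U where "open U" "T = Some ` U"
    | C where "compact C" "closed C" "T = insert None (Some ` (UNIV - C))"
    unfolding openin_Alexandroff_compactification by auto
  then show ?thesis
  proof cases
    case 1
    then show ?thesis by (simp add: inj_vimage_image_eq)
  next
    case 2
    then have "Some -` T = - C" by auto
    with 2 show ?thesis by (simp add: open_Compl)
  qed
qed

text \<open>The space is open in its compactification, so the added point has no influence on limit
  points elsewhere.\<close>

lemma Some_derived_set_of_iff:
  "Some x \<in> one_point derived_set_of S \<longleftrightarrow> x islimpt (Some -` S)"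
proof
  assume x: "Some x \<in> one_point derived_set_of S"
  show "x islimpt (Some -` S)"
    unfolding islimpt_def
  proof (intro allI impI)
    fix T assume T: "x \<in> T" "open T"
    then have "openin one_point (Some ` T)" "Some x \<in> Some ` T" by simp_all
    then obtain y where "y \<noteq> Some x" "y \<in> S" "y \<in> Some ` T"
      using x unfolding derived_set_of_def by blast
    then show "\<exists>y\<in>Some -` S. y \<in> T \<and> y \<noteq> x" by blast
  qed
next
  assume x: "x islimpt (Some -` S)"
  have "\<exists>y. y \<noteq> Some x \<and> y \<in> S \<and> y \<in> T" if T: "Some x \<in> T" "openin one_point T" for T
  proof -
    obtain y where "y \<in> Some -` S" "y \<in> Some -` T" "y \<noteq> x"
      using x open_Some_vimage[OF T(2)] T(1) by (meson islimptE vimageI2)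
    then show ?thesis by blast
  qed
  then show "Some x \<in> one_point derived_set_of S"
    unfolding derived_set_of_def by auto
qed

text \<open>The complement of a compact set is a neighbourhood of the point at infinity.\<close>

lemma None_derived_set_of:
  assumes "None \<in> one_point derived_set_of S" "compact (C :: 'a::t2_space set)"
  shows "\<not> Some -` S \<subseteq> C"
proof -
  let ?T = "insert None (Some ` (UNIV - C))"
  have "openin one_point ?T"
    unfolding openin_Alexandroff_compactification
    using assms(2) compact_imp_closed[OF assms(2)]
    by (intro disjI2 exI[of _ C]) simp
  then obtain y where "y \<noteq> None" "y \<in> S" "y \<in> ?T"
    using assms(1) unfolding derived_set_of_def by blast
  then show ?thesis by auto
qed

lemma iterated_derived_set_Suc:
  "iterated_derived_set (Suc n) X = X derived_set_of (iterated_derived_set n X)"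
  by (simp add: iterated_derived_set_def)

lemma Some_vimage_iterated_derived_set:
  "Some -` iterated_derived_set n one_point = (derived n :: 'a::t2_space set)"
proof (induction n)
  case 0
  then show ?case by (auto simp: iterated_derived_set_def derived_def)
next
  case (Suc n)
  show ?case
    by (auto simp: iterated_derived_set_Suc derived_Suc Some_derived_set_of_iff Suc)
qed

lemma Some_infinite_derived_set_imp:
  assumes "Some q \<in> infinite_derived_set one_point"
  shows "q islimpt derived n"
proof -
  have "q \<in> Some -` iterated_derived_set (Suc n) one_point"
    using INT_D[OF assms[unfolded infinite_derived_set_def], of "Suc n"] by simp
  then show ?thesis by (simp add: Some_vimage_iterated_derived_set derived_Suc)
qed

lemma None_infinite_derived_set_imp:
  assumes "None \<in> infinite_derived_set (one_point :: 'a::t2_space option topology)"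
  shows "\<not> compact (derived n :: 'a set)"
proof
  assume "compact (derived n :: 'a set)"
  moreover have "None \<in> iterated_derived_set (Suc n) (one_point :: 'a option topology)"
    using assms unfolding infinite_derived_set_def by (rule INT_D) simp
  ultimately show False
    using None_derived_set_of Some_vimage_iterated_derived_set
    unfolding iterated_derived_set_Suc by blast
qed

context locally_compact_metric
begin

lemma gauge_at_point:
  assumes "Some q \<in> infinite_derived_set (one_point :: 'a option topology)" "e > 0"
  shows "\<exists>x\<in>derived m. 0 < d q x \<and> d q x < e"
proof -
  have "q islimpt derived m" by (rule Some_infinite_derived_set_imp[OF assms(1)])
  moreover have "q \<in> {x. d q x < e}" using assms(2) by simp
  ultimately obtain x where "x \<in> derived m" "x \<in> {x. d q x < e}" "x \<noteq> q"
    using open_dist_ball by (meson islimptE)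
  then show ?thesis by (intro bexI[of _ x]) auto
qed

text \<open>A strictly positive function in C_0 exists only on a sigma-compact space. Instead,
  choose in each derived set a countable infinite set without limit points, let \<open>S\<close> be
  their union, and add the distance to \<open>S\<close> to a function in C_0 that is positive on the
  closure of \<open>S\<close>. On \<open>S\<close> only the latter remains.\<close>

lemma gauge_at_infinity:
  assumes "None \<in> infinite_derived_set (one_point :: 'a option topology)"
  obtains \<gamma> :: "'a \<Rightarrow> real" where "continuous_on UNIV \<gamma>" "\<And>x. 0 < \<gamma> x"
    "\<And>m e. e > 0 \<Longrightarrow> \<exists>x\<in>derived m. \<gamma> x < e"
proof -
  have "\<exists>A. countable A \<and> infinite A \<and> A \<subseteq> (derived m :: 'a set) \<and> (\<forall>x. \<not> x islimpt A)" for m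
  proof -
    have "\<not> compactin (Metric_space.mtopology UNIV d) (derived m :: 'a set)"
      using None_infinite_derived_set_imp[OF assms] by (simp add: mtopology)
    then obtain T where T: "T \<subseteq> derived m" "infinite T"
      "derived m \<inter> mtopology derived_set_of T = {}"
      unfolding compactin_eq_Bolzano_Weierstrass by auto
    obtain A where A: "A \<subseteq> T" "countable A" "infinite A"
      using infinite_countable_subset'[OF T(2)] by blast
    have "\<not> x islimpt A" for x
    proof
      assume "x islimpt A"
      then have x: "x islimpt T" using A(1) islimpt_subset by blast
      \<comment> \<open>Non-compactness only excludes limit points inside \<open>derived m\<close>;
        since this set is closed, there are none elsewhere.\<close>
      then have "x \<in> derived m"
        using closed_derived T(1) islimpt_subset closed_limpt by metis
      moreover have "x \<in> mtopology derived_set_of T"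
        unfolding metric_derived_set_of
      proof (intro CollectI conjI allI impI UNIV_I)
        fix r :: real assume "r > 0"
        then have "x \<in> {y. d x y < r}" by simp
        then obtain y where "y \<in> T" "y \<in> {y. d x y < r}" "y \<noteq> x"
          using x open_dist_ball by (meson islimptE)
        then show "\<exists>y\<in>T. y \<noteq> x \<and> y \<in> mball x r" by auto
      qed
      ultimately show False using T(3) by blast
    qed
    with A T(1) show ?thesis by blast
  qed
  then have "\<exists>A. \<forall>m. countable (A m) \<and> infinite (A m) \<and> A m \<subseteq> (derived m :: 'a set) \<and>
      (\<forall>x. \<not> x islimpt A m)"
    by (intro choice) blast
  then obtain A :: "nat \<Rightarrow> 'a set" where "\<forall>m. countable (A m) \<and> infinite (A m) \<and>
      A m \<subseteq> derived m \<and> (\<forall>x. \<not> x islimpt A m)"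
    by (rule exE)
  then have A: "\<And>m. countable (A m)" "\<And>m. infinite (A m)" "\<And>m. A m \<subseteq> derived m"
    "\<And>m x. \<not> x islimpt A m" by simp_all
  define S where "S = (\<Union>m. A m)"
  have S: "countable S" "S \<noteq> {}" using A(1) infinite_imp_nonempty[OF A(2)] by (auto simp: S_def)
  obtain g where g: "vanishing g" "\<And>x. x \<in> closure S \<Longrightarrow> g x > 0"
    using vanishing_positive_on_closure[OF S(1)] by blast
  have gc: "continuous_on UNIV g" "\<And>x. 0 \<le> g x" using g(1) by (auto simp: vanishing_def)
  define \<gamma> where "\<gamma> x = g x + set_dist S x" for x
  have "continuous_on UNIV \<gamma>"
    unfolding \<gamma>_def by (intro continuous_intros gc continuous_on_set_dist S)
  moreover have "0 < \<gamma> x" for x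
    using g(2)[of x] gc(2)[of x] set_dist_nonneg[OF S(2), of x] set_dist_eq_0_iff[OF S(2), of x]
    unfolding \<gamma>_def by linarith
  moreover have "\<exists>x\<in>derived m. \<gamma> x < e" if "e > 0" for m e
  proof -
    have "compact {x. e \<le> g x}" using g(1) that by (simp add: vanishing_def)
    \<comment> \<open>An infinite subset of a compact set would have a limit point.\<close>
    then have "\<not> A m \<subseteq> {x. e \<le> g x}"
      using Heine_Borel_imp_Bolzano_Weierstrass A(2,4) by blast
    then obtain x where x: "x \<in> A m" "g x < e"
      by (metis (mono_tags) linorder_not_le mem_Collect_eq subsetI)
    then have "x \<in> closure S" using closure_subset[of S] by (auto simp: S_def)
    then have "\<gamma> x = g x" using set_dist_eq_0_iff[OF S(2)] by (simp add: \<gamma>_def)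
    then show ?thesis using x A(3)[of m] by (intro bexI[of _ x]) auto
  qed
  ultimately show ?thesis using that by blast
qed

text \<open>For a point \<open>q\<close> the function is the distance to \<open>q\<close>. For the
  point at infinity the sets \<open>{x. \<gamma> x < e}\<close> need not be neighbourhoods of it, so
  the last clause speaks of points of the space; there, positivity of \<gamma> will prevent support
  at a point.\<close>

lemma gauge:
  assumes "p \<in> infinite_derived_set (one_point :: 'a option topology)"
  obtains \<gamma> :: "'a \<Rightarrow> real" where "continuous_on UNIV \<gamma>" "\<And>x. 0 \<le> \<gamma> x"
    "\<And>x. \<gamma> x = 0 \<longleftrightarrow> p = Some x" "\<And>m e. e > 0 \<Longrightarrow> \<exists>x\<in>derived m. 0 < \<gamma> x \<and> \<gamma> x < e"
    "\<And>q U. p = Some q \<Longrightarrow> open U \<Longrightarrow> q \<in> U \<Longrightarrow> \<exists>e>0. {x. \<gamma> x < e} \<subseteq> U"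
proof (cases p)
  case None
  obtain \<gamma> :: "'a \<Rightarrow> real" where "continuous_on UNIV \<gamma>" "\<And>x. 0 < \<gamma> x"
    "\<And>m e. e > 0 \<Longrightarrow> \<exists>x\<in>derived m. \<gamma> x < e"
    using gauge_at_infinity assms None by blast
  then show ?thesis
    using None by (intro that[of \<gamma>]) (auto simp: less_imp_le less_imp_neq[symmetric])
next
  case (Some q)
  have "\<exists>e>0. {x. d q x < e} \<subseteq> U" if "open U" "q \<in> U" for U
    using that unfolding open_iff by blast
  then show ?thesis
    using Some gauge_at_point assms by (intro that[of "d q"] continuous_on_metric) auto
qed

text \<open>Positivity requires labels of infinitely many lengths, but only finitely many lengths
  occur where \<gamma> is at least \<open>e\<close>. Hence positive sets come arbitrarily close to
  \<open>p\<close> as measured by \<gamma>.\<close>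

lemma labelled_neighbourhoods:
  assumes "p \<in> infinite_derived_set (one_point :: 'a option topology)"
  obtains \<gamma> :: "'a \<Rightarrow> real" and lam where "continuous_on UNIV \<gamma>" "\<And>x. 0 \<le> \<gamma> x"
    "\<And>x. \<gamma> x = 0 \<longleftrightarrow> p = Some x"
    "\<And>q U. p = Some q \<Longrightarrow> open U \<Longrightarrow> q \<in> U \<Longrightarrow> \<exists>e>0. {x. \<gamma> x < e} \<subseteq> U"
    "labelling lam" "labels \<subseteq> ran lam"
    "\<And>e \<alpha>. e > 0 \<Longrightarrow> \<not> positive_at lam \<alpha> {x. e \<le> \<gamma> x}"
proof -
  obtain \<gamma> :: "'a \<Rightarrow> real" where \<gamma>: "continuous_on UNIV \<gamma>" "\<And>x. 0 \<le> \<gamma> x"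
    "\<And>x. \<gamma> x = 0 \<longleftrightarrow> p = Some x"
    "\<And>q U. p = Some q \<Longrightarrow> open U \<Longrightarrow> q \<in> U \<Longrightarrow> \<exists>e>0. {x. \<gamma> x < e} \<subseteq> U"
    and small: "\<And>m e. e > 0 \<Longrightarrow> \<exists>x\<in>derived m. 0 < \<gamma> x \<and> \<gamma> x < e"
    by (rule gauge[OF assms]) blast
  obtain lam where lam: "labelling lam" "labels \<subseteq> ran lam"
    and fin: "\<And>e. e > 0 \<Longrightarrow> finite {length (fst l) | l x. e \<le> \<gamma> x \<and> lam x = Some l}"
    by (rule labelling_along[where D = derived and \<gamma> = \<gamma>])
       (use \<gamma>(1) small in \<open>auto simp: derived_Suc\<close>)
  have "\<not> positive_at lam \<alpha> {x. e \<le> \<gamma> x}" if "e > 0" for e \<alpha>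
  proof
    assume "positive_at lam \<alpha> {x. e \<le> \<gamma> x}"
    then obtain G where
      fr: "\<exists>\<^sub>F n in sequentially. \<exists>x\<in>{x. e \<le> \<gamma> x}. lam x = Some (res n \<alpha>, res n ` G)"
      by (rule positiveD[of _ _ _ "{\<alpha>}"]) auto
    obtain N where N: "\<forall>n\<in>{length (fst l) | l x. e \<le> \<gamma> x \<and> lam x = Some l}. n \<le> N"
      using fin[OF \<open>e > 0\<close>] finite_nat_set_iff_bounded_le by blast
    from frequently_eventually_frequently[OF fr eventually_gt_at_top[of N]]
    obtain n x where "e \<le> \<gamma> x" "lam x = Some (res n \<alpha>, res n ` G)" "n > N"
      using frequently_ex by (smt (verit) mem_Collect_eq)
    moreover from this have "n \<in> {length (fst l) | l x. e \<le> \<gamma> x \<and> lam x = Some l}" by force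
    ultimately show False using N by fastforce
  qed
  with \<gamma> lam show ?thesis by (rule that)
qed

end

subsection \<open>Prime filters of open sets and ideals\<close>

lemma positive_labelled:
  assumes "positive_at lam \<alpha> S"
  obtains x n G where "x \<in> S" "lam x = Some (res n \<alpha>, G)"
proof -
  from positiveD[OF assms, of "{\<alpha>}"] obtain G
    where "\<exists>\<^sub>F n in sequentially. \<exists>x\<in>S. lam x = Some (res n \<alpha>, res n ` G)" by auto
  then show ?thesis using that frequently_ex by blast
qed

text \<open>The same maximality lemma is applied twice: to failure of positivity at some \<alpha>,
  giving \<open>Q\<close>, and then above \<open>Q\<close> to failure at a given \<alpha>. In the
  second case the avoided sets form an ideal, so maximality yields primeness and the rule about
  complements.\<close>

lemma pseudo_finite_prime_open_filters:
  fixes lam :: "'a::topological_space \<Rightarrow> label option"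
  assumes lam: "labelling lam" "labels \<subseteq> ran lam"
  obtains \<U> where "\<And>\<alpha>. open_filter (\<U> \<alpha>)"
    "\<And>\<alpha> U V. open U \<Longrightarrow> open V \<Longrightarrow> U \<union> V \<in> \<U> \<alpha> \<Longrightarrow> U \<in> \<U> \<alpha> \<or> V \<in> \<U> \<alpha>"
    "\<And>\<alpha> U. U \<in> \<U> \<alpha> \<Longrightarrow> positive_at lam \<alpha> U"
    "\<And>\<alpha> U. open U \<Longrightarrow> \<not> positive_at lam \<alpha> (- U) \<Longrightarrow> U \<in> \<U> \<alpha>"
    "\<And>\<alpha> U. open U \<Longrightarrow> U \<notin> \<U> \<alpha> \<Longrightarrow> finite {\<beta>. U \<in> \<U> \<beta>}"
proof -
  define small where "small = {A. \<exists>\<alpha>. \<not> positive_at lam \<alpha> A}"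
  have mono: "positive_at lam \<alpha> B" if "positive_at lam \<alpha> A" "A \<subseteq> B" for \<alpha> A B
    using that by (auto intro: positive_mono)
  have "open_filter {UNIV :: 'a set}" by (rule open_filterI) auto
  moreover have "{UNIV} \<inter> small = {}"
    using positive_UNIV[OF lam(2)] by (auto simp: small_def)
  moreover have "B \<in> small" if "A \<in> small" "B \<subseteq> A" for A B
    using that mono unfolding small_def by blast
  ultimately obtain Q where Q: "open_filter Q" "Q \<inter> small = {}"
    and Qmax: "\<And>U. open U \<Longrightarrow> U \<notin> Q \<Longrightarrow> \<exists>V\<in>Q. U \<inter> V \<in> small"
    using maximal_open_filter[of "{UNIV}" small] by metis
  have "\<exists>F. open_filter F \<and> Q \<subseteq> F \<and> (\<forall>U\<in>F. positive_at lam \<alpha> U) \<and>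
    (\<forall>U. open U \<and> U \<notin> F \<longrightarrow> (\<exists>V\<in>F. \<not> positive_at lam \<alpha> (U \<inter> V)))" for \<alpha>
  proof -
    have Qs: "Q \<inter> {A. \<not> positive_at lam \<alpha> A} = {}" using Q(2) by (auto simp: small_def)
    obtain F where "open_filter F" "Q \<subseteq> F" "F \<inter> {A. \<not> positive_at lam \<alpha> A} = {}"
      "\<And>U. open U \<Longrightarrow> U \<notin> F \<Longrightarrow> \<exists>V\<in>F. U \<inter> V \<in> {A. \<not> positive_at lam \<alpha> A}"
      by (rule maximal_open_filter[OF Q(1) Qs]) (use mono in blast)+
    then show ?thesis by (intro exI[of _ F]) auto
  qed
  then obtain \<U> where filter: "\<And>\<alpha>. open_filter (\<U> \<alpha>)" and QU: "\<And>\<alpha>. Q \<subseteq> \<U> \<alpha>"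
    and pos: "\<And>\<alpha> U. U \<in> \<U> \<alpha> \<Longrightarrow> positive_at lam \<alpha> U"
    and max: "\<And>\<alpha> U. open U \<Longrightarrow> U \<notin> \<U> \<alpha> \<Longrightarrow> \<exists>V\<in>\<U> \<alpha>. \<not> positive_at lam \<alpha> (U \<inter> V)"
    by metis
  have prime: "U \<in> \<U> \<alpha> \<or> V \<in> \<U> \<alpha>" if UV: "open U" "open V" "U \<union> V \<in> \<U> \<alpha>" for \<alpha> U V
  proof (rule ccontr)
    assume no: "\<not> ?thesis"
    obtain U' where U': "U' \<in> \<U> \<alpha>" "\<not> positive_at lam \<alpha> (U \<inter> U')" using max UV(1) no by blast
    obtain V' where V': "V' \<in> \<U> \<alpha>" "\<not> positive_at lam \<alpha> (V \<inter> V')" using max UV(2) no by blast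
    have "(U \<union> V) \<inter> (U' \<inter> V') \<in> \<U> \<alpha>"
      using UV(3) U'(1) V'(1) open_filterD(3)[OF filter] by blast
    from mono[OF pos[OF this], of "(U \<inter> U') \<union> (V \<inter> V')"]
    have "positive_at lam \<alpha> ((U \<inter> U') \<union> (V \<inter> V'))" by blast
    with U'(2) V'(2) positive_UnD show False by blast
  qed
  have compl: "U \<in> \<U> \<alpha>" if U: "open U" "\<not> positive_at lam \<alpha> (- U)" for \<alpha> U
  proof (rule ccontr)
    assume "U \<notin> \<U> \<alpha>"
    then obtain V where V: "V \<in> \<U> \<alpha>" "\<not> positive_at lam \<alpha> (U \<inter> V)" using max U(1) by blast
    from mono[OF pos[OF V(1)], of "(U \<inter> V) \<union> (- U)"]
    have "positive_at lam \<alpha> ((U \<inter> V) \<union> (- U))" by blast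
    with U(2) V(2) positive_UnD show False by blast
  qed
  have fin: "finite {\<beta>. U \<in> \<U> \<beta>}" if U: "open U" "U \<notin> \<U> \<alpha>" for \<alpha> U
  proof -
    have "U \<notin> Q" using U(2) QU by blast
    then obtain V \<beta> where V: "V \<in> Q" "\<not> positive_at lam \<beta> (U \<inter> V)"
      using Qmax[OF U(1)] by (auto simp: small_def)
    have "open (U \<inter> V)" using U(1) open_filterD(1)[OF Q(1) V(1)] by (rule open_Int)
    then have *: "finite {\<beta>. positive_at lam \<beta> (U \<inter> V)}"
      using positive_of_infinite[OF lam(1)] V(2) by blast
    have "positive_at lam \<beta> (U \<inter> V)" if "U \<in> \<U> \<beta>" for \<beta>
      using that V(1) QU[of \<beta>] open_filterD(3)[OF filter[of \<beta>]] pos by blast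
    then have "{\<beta>. U \<in> \<U> \<beta>} \<subseteq> {\<beta>. positive_at lam \<beta> (U \<inter> V)}" by blast
    then show ?thesis using * by (rule finite_subset)
  qed
  show ?thesis using filter prime pos compl fin by (rule that)
qed

section \<open>C_0 and its ideals\<close>

lemma closed_zero_set_C_fun:
  fixes f :: "'a::topological_space \<Rightarrow> 'k::real_or_complex"
  assumes "f \<in> C_fun"
  shows "closed (zero_set f)"
  unfolding zero_set_def
  by (intro closed_Collect_eq continuous_on_const) (use assms in \<open>simp add: C_fun_def\<close>)

lemma C0_fun_subset_C_fun: "(C0_fun :: ('a::topological_space \<Rightarrow> 'k::real_or_complex) set) \<subseteq> C_fun"
  by (auto simp: C0_fun_def)

lemma C0_funI:
  fixes f :: "'a::topological_space \<Rightarrow> 'k::real_or_complex"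
  assumes "f \<in> C_fun" "\<And>e. e > 0 \<Longrightarrow> \<exists>C. compact C \<and> {x. e \<le> norm (f x)} \<subseteq> C"
  shows "f \<in> C0_fun"
proof -
  have "compact {x. e \<le> norm (f x)}" if "e > 0" for e
  proof -
    obtain C where C: "compact C" "{x. e \<le> norm (f x)} \<subseteq> C" using assms(2)[OF \<open>e > 0\<close>] by blast
    have "closed {x. e \<le> norm (f x)}"
      using assms(1) by (intro closed_Collect_le continuous_intros) (simp add: C_fun_def)
    then have "compact (C \<inter> {x. e \<le> norm (f x)})" by (rule compact_Int_closed[OF C(1)])
    moreover have "C \<inter> {x. e \<le> norm (f x)} = {x. e \<le> norm (f x)}" using C(2) by auto
    ultimately show ?thesis by simp
  qed
  then show ?thesis using assms(1) by (simp add: C0_fun_def)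
qed

lemma C0_fun_compact:
  fixes f :: "'a::topological_space \<Rightarrow> 'k::real_or_complex"
  shows "f \<in> C0_fun \<Longrightarrow> e > 0 \<Longrightarrow> compact {x. e \<le> norm (f x)}"
  by (simp add: C0_fun_def)

lemma C0_fun_add:
  fixes f g :: "'a::topological_space \<Rightarrow> 'k::real_or_complex"
  assumes "f \<in> C0_fun" "g \<in> C0_fun"
  shows "(\<lambda>x. f x + g x) \<in> C0_fun"
proof (rule C0_funI)
  show "(\<lambda>x. f x + g x) \<in> C_fun"
    using assms by (auto simp: C0_fun_def C_fun_def intro: continuous_on_add)
  fix e :: real assume "e > 0"
  have "{x. e \<le> norm (f x + g x)} \<subseteq> {x. e/2 \<le> norm (f x)} \<union> {x. e/2 \<le> norm (g x)}"
  proof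
    fix x assume "x \<in> {x. e \<le> norm (f x + g x)}"
    then show "x \<in> {x. e/2 \<le> norm (f x)} \<union> {x. e/2 \<le> norm (g x)}"
      using norm_triangle_ineq[of "f x" "g x"] by auto
  qed
  moreover have "compact ({x. e/2 \<le> norm (f x)} \<union> {x. e/2 \<le> norm (g x)})"
    using assms \<open>e > 0\<close> by (intro compact_Un C0_fun_compact) auto
  ultimately show "\<exists>C. compact C \<and> {x. e \<le> norm (f x + g x)} \<subseteq> C" by blast
qed

lemma C0_fun_mult:
  fixes f g :: "'a::topological_space \<Rightarrow> 'k::real_or_complex"
  assumes "f \<in> C0_fun" "g \<in> C0_fun"
  shows "(\<lambda>x. f x * g x) \<in> C0_fun"
proof (rule C0_funI)
  show "(\<lambda>x. f x * g x) \<in> C_fun"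
    using assms by (auto simp: C0_fun_def C_fun_def intro: continuous_on_mult)
  fix e :: real assume e: "e > 0"
  have "{x. e \<le> norm (f x * g x)} \<subseteq> {x. sqrt e \<le> norm (f x)} \<union> {x. sqrt e \<le> norm (g x)}"
  proof (rule ccontr)
    assume "\<not> ?thesis"
    then obtain x where x: "e \<le> norm (f x) * norm (g x)" "norm (f x) < sqrt e" "norm (g x) < sqrt e"
      by (auto simp: norm_mult subset_iff not_le)
    have "norm (f x) * norm (g x) < sqrt e * sqrt e"
      using x(2,3) by (intro mult_strict_mono') auto
    then show False using x(1) e by simp
  qed
  moreover have "compact ({x. sqrt e \<le> norm (f x)} \<union> {x. sqrt e \<le> norm (g x)})"
    using assms e by (intro compact_Un C0_fun_compact) auto
  ultimately show "\<exists>C. compact C \<and> {x. e \<le> norm (f x * g x)} \<subseteq> C" by blast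
qed

lemma C0_fun_scale:
  fixes f :: "'a::topological_space \<Rightarrow> 'k::real_or_complex"
  assumes "f \<in> C0_fun"
  shows "(\<lambda>x. c * f x) \<in> C0_fun"
proof (rule C0_funI)
  show "(\<lambda>x. c * f x) \<in> C_fun"
    using assms by (auto simp: C0_fun_def C_fun_def intro: continuous_on_mult continuous_on_const)
  fix e :: real assume e: "e > 0"
  \<comment> \<open>The summand 1 covers \<open>c = 0\<close>.\<close>
  define r where "r = e / (norm c + 1)"
  have "norm c + 1 > 0" by (simp add: add_nonneg_pos)
  then have r: "r > 0" "r * (norm c + 1) = e" using e by (auto simp: r_def)
  have "{x. e \<le> norm (c * f x)} \<subseteq> {x. r \<le> norm (f x)}"
  proof (rule ccontr)
    assume "\<not> ?thesis"
    then obtain x where x: "e \<le> norm c * norm (f x)" "norm (f x) < r"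
      by (auto simp: norm_mult subset_iff not_le)
    have "norm c * norm (f x) \<le> norm c * r" using x(2) by (intro mult_left_mono) auto
    also have "\<dots> < e" using r by (simp add: algebra_simps flip: r(2))
    finally show False using x(1) by simp
  qed
  then show "\<exists>C. compact C \<and> {x. e \<le> norm (c * f x)} \<subseteq> C"
    using C0_fun_compact[OF assms r(1)] by blast
qed

lemma C0_fun_zero: "(\<lambda>x::'a::topological_space. 0 :: 'k::real_or_complex) \<in> C0_fun"
  by (auto simp: C0_fun_def C_fun_def)

text \<open>The zero set of a product is the union of the zero sets, so primeness carries over.
  Properness is a separate matter: without sigma-compactness a prime z-filter may contain the zero
  sets of all functions in C_0.\<close>

lemma prime_z_filter_ideal:
  fixes F :: "'a::topological_space set set"
  assumes F: "prime_z_filter TYPE('k::real_or_complex) F"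
    and proper: "C0_fun \<inter> Z_inverse F \<noteq> (C0_fun :: ('a \<Rightarrow> 'k) set)"
  shows "C0_prime_ideal (C0_fun \<inter> Z_inverse F :: ('a \<Rightarrow> 'k) set)"
    and "C0_z_ideal (C0_fun \<inter> Z_inverse F :: ('a \<Rightarrow> 'k) set)"
proof -
  let ?P = "C0_fun \<inter> Z_inverse F :: ('a \<Rightarrow> 'k) set"
  have zf: "z_filter TYPE('k) F" using F by (simp add: prime_z_filter_def)
  have zs: "zero_set f \<in> zero_sets TYPE('k)" if "f \<in> C0_fun" for f :: "'a \<Rightarrow> 'k"
    using that C0_fun_subset_C_fun by (auto simp: zero_sets_def)
  have P_iff: "f \<in> ?P \<longleftrightarrow> f \<in> C0_fun \<and> zero_set f \<in> F" for f :: "'a \<Rightarrow> 'k"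
    using C0_fun_subset_C_fun by (auto simp: Z_inverse_def)
  have up: "Z' \<in> F" if "Z \<in> F" "Z' \<in> zero_sets TYPE('k)" "Z \<subseteq> Z'" for Z Z'
    using zf that unfolding z_filter_def by blast
  have int: "Z \<inter> Z' \<in> F" if "Z \<in> F" "Z' \<in> F" for Z Z'
    using zf that unfolding z_filter_def by blast
  have z: "g \<in> ?P" if "f \<in> ?P" "g \<in> C0_fun" "zero_set f \<subseteq> zero_set g" for f g :: "'a \<Rightarrow> 'k"
    using that up zs P_iff by blast
  have zero: "(\<lambda>x. 0) \<in> ?P"
  proof -
    obtain Z where "Z \<in> F" using zf unfolding z_filter_def by blast
    then have "zero_set (\<lambda>x::'a. 0::'k) \<in> F"
      by (rule up) (use zs[OF C0_fun_zero] in \<open>auto simp: zero_set_def\<close>)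
    then show ?thesis using P_iff C0_fun_zero by blast
  qed
  have add: "(\<lambda>x. f x + g x) \<in> ?P" if "f \<in> ?P" "g \<in> ?P" for f g :: "'a \<Rightarrow> 'k"
  proof -
    have *: "f \<in> C0_fun" "g \<in> C0_fun" "zero_set f \<inter> zero_set g \<in> F"
      using that P_iff int by auto
    have "zero_set (\<lambda>x. f x + g x) \<in> F"
      by (rule up[OF *(3) zs[OF C0_fun_add[OF *(1,2)]]]) (auto simp: zero_set_def)
    then show ?thesis using P_iff C0_fun_add[OF *(1,2)] by blast
  qed
  have scale: "(\<lambda>x. c * f x) \<in> ?P" if "f \<in> ?P" for c :: 'k and f :: "'a \<Rightarrow> 'k"
    by (rule z[OF that C0_fun_scale]) (use that in \<open>auto simp: zero_set_def\<close>)
  have mult: "(\<lambda>x. g x * f x) \<in> ?P" if "f \<in> ?P" "g \<in> C0_fun" for f g :: "'a \<Rightarrow> 'k"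
    by (rule z[OF that(1) C0_fun_mult]) (use that in \<open>auto simp: zero_set_def\<close>)
  have ideal: "C0_ideal ?P"
    unfolding C0_ideal_def using zero add scale mult by blast
  show "C0_z_ideal ?P"
    unfolding C0_z_ideal_def using ideal z by blast
  have "f \<in> ?P \<or> g \<in> ?P"
    if fg: "f \<in> C0_fun" "g \<in> C0_fun" "(\<lambda>x. f x * g x) \<in> ?P" for f g :: "'a \<Rightarrow> 'k"
  proof -
    have "zero_set (\<lambda>x. f x * g x) = zero_set f \<union> zero_set g" by (auto simp: zero_set_def)
    then have "zero_set f \<union> zero_set g \<in> F" using fg(3) P_iff by metis
    then have "zero_set f \<in> F \<or> zero_set g \<in> F"
      using F zs[OF fg(1)] zs[OF fg(2)] unfolding prime_z_filter_def by blast
    then show ?thesis using fg P_iff by blast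
  qed
  then show "C0_prime_ideal ?P"
    unfolding C0_prime_ideal_def using ideal proper by blast
qed

lemma non_redundantI:
  assumes "\<And>\<alpha>. \<alpha> \<in> S \<Longrightarrow> \<exists>a\<in>A. a \<notin> P \<alpha> \<and> (\<forall>\<beta>\<in>S. \<beta> \<noteq> \<alpha> \<longrightarrow> a \<in> P \<beta>)"
  shows "non_redundant A S P"
  unfolding non_redundant_def
proof (intro allI impI)
  fix T assume "T \<subset> S"
  then obtain \<alpha> where \<alpha>: "\<alpha> \<in> S" "\<alpha> \<notin> T" "T \<subseteq> S" by blast
  then obtain a where "a \<in> A" "a \<notin> P \<alpha>" "\<forall>\<beta>\<in>S. \<beta> \<noteq> \<alpha> \<longrightarrow> a \<in> P \<beta>" using assms by blast
  then have "a \<in> A \<inter> (\<Inter>i\<in>T. P i)" "a \<notin> A \<inter> (\<Inter>i\<in>S. P i)" using \<alpha> by auto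
  then show "A \<inter> (\<Inter>i\<in>T. P i) \<noteq> A \<inter> (\<Inter>i\<in>S. P i)" by metis
qed

section \<open>Cardinalities; the index set is all of Cantor space\<close>

lemma continuum_eq: "continuum = card_of (UNIV :: (nat \<Rightarrow> bool) set)"
proof -
  have "Func (UNIV :: nat set) (UNIV :: bool set) = UNIV" by (simp add: Func_def)
  then show ?thesis
    by (simp add: continuum_def cexp_def ctwo_def Field_natLeq Field_card_of)
qed

lemma Field_continuum: "Field continuum = UNIV"
  by (simp add: continuum_eq Field_card_of)

text \<open>The scalars are an image of the real plane, spanned over the reals by 1 and
  \<open>i\<close>, with \<open>i = 0\<close> in the real case.\<close>

lemma card_scalars:
  "(card_of (UNIV :: 'k::real_or_complex set), card_of (UNIV :: nat set set)) \<in> ordLeq"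
proof -
  obtain i :: 'k where i: "\<And>x. \<exists>a b. x = a *\<^sub>R 1 + b *\<^sub>R i"
  proof (cases "\<forall>x::'k. \<exists>a. x = a *\<^sub>R 1")
    case True
    then have "\<exists>a b. x = a *\<^sub>R 1 + b *\<^sub>R (0::'k)" for x :: 'k by simp
    then show ?thesis using that by blast
  next
    case False
    then show ?thesis using real_or_complex[where 'a = 'k] that by blast
  qed
  have "x \<in> range (\<lambda>(a, b). a *\<^sub>R 1 + b *\<^sub>R i)" for x using i[of x] by auto
  then have "(UNIV :: 'k set) = (\<lambda>(a, b). a *\<^sub>R 1 + b *\<^sub>R i) ` (UNIV \<times> UNIV)" by auto
  then have "(card_of (UNIV :: 'k set), card_of ((UNIV :: real set) \<times> (UNIV :: real set))) \<in> ordLeq"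
    using card_of_image by metis
  also have "(card_of ((UNIV :: real set) \<times> (UNIV :: real set)), card_of (UNIV :: real set)) \<in> ordIso"
    by (rule card_of_Times_same_infinite) (rule infinite_UNIV_char_0)
  also have "(card_of (UNIV :: real set), card_of (UNIV :: nat set set)) \<in> ordIso"
    using nat_sets_eqpoll_reals card_of_ordIso ordIso_symmetric unfolding eqpoll_def by blast
  finally show ?thesis .
qed

text \<open>Code scalars as sets of naturals; a sequence of such sets is a subset of a countable
  grid, which the pairing function turns into a single 0-1 sequence.\<close>

lemma card_sequences:
  "(card_of (UNIV :: (nat \<Rightarrow> 'k::real_or_complex) set), continuum) \<in> ordLeq"
proof -
  obtain \<iota> :: "'k \<Rightarrow> nat set" where \<iota>: "inj \<iota>"
    using card_scalars[where 'k = 'k] unfolding card_of_ordLeq[symmetric] by blast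
  define \<phi> where "\<phi> u n \<longleftrightarrow> snd (prod_decode n) \<in> \<iota> (u (fst (prod_decode n)))"
    for u :: "nat \<Rightarrow> 'k" and n
  have "inj \<phi>"
  proof (rule injI, rule ext)
    fix u v i assume "\<phi> u = \<phi> v"
    then have "\<phi> u (prod_encode (i, j)) = \<phi> v (prod_encode (i, j))" for j by simp
    then have "\<iota> (u i) = \<iota> (v i)" by (auto simp: \<phi>_def)
    then show "u i = v i" using \<iota> by (rule injD[rotated])
  qed
  then show ?thesis unfolding continuum_eq card_of_ordLeq[symmetric] by blast
qed

subsection \<open>The family of prime filters\<close>

context locally_compact_metric
begin

text \<open>Distance to a closed set is a real function with that zero set, and
  \<open>of_real\<close> carries it to either scalar field.\<close>

lemma zero_sets_eq: "(zero_sets TYPE('k::real_or_complex) :: 'a set set) = Collect closed"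
proof (intro equalityI subsetI)
  fix Z :: "'a set" assume "Z \<in> zero_sets TYPE('k)"
  then show "Z \<in> Collect closed"
    using closed_zero_set_C_fun unfolding zero_sets_def by blast
next
  fix Z :: "'a set" assume "Z \<in> Collect closed"
  then obtain f :: "'a \<Rightarrow> real" where f: "continuous_on UNIV f" "\<And>x. f x = 0 \<longleftrightarrow> x \<in> Z"
    using closed_zero_set by blast
  have "(\<lambda>x. of_real (f x) :: 'k) \<in> C_fun"
    using f(1) by (simp add: C_fun_def continuous_on_of_real)
  moreover have "zero_set (\<lambda>x. of_real (f x) :: 'k) = Z"
    using f(2) by (auto simp: zero_set_def)
  ultimately show "Z \<in> zero_sets TYPE('k)"
    unfolding zero_sets_def by blast
qed

lemma vanishing_of_real:
  assumes "vanishing g"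
  shows "(\<lambda>x. of_real (g x) :: 'k::real_or_complex) \<in> C0_fun"
  using assms by (simp add: vanishing_def C0_fun_def C_fun_def continuous_on_of_real)

lemma vanishing_restrict:
  assumes g: "vanishing g" and U: "open U"
  obtains h where "vanishing h" "\<And>x. h x = 0 \<longleftrightarrow> x \<notin> U \<or> g x = 0"
proof -
  obtain f :: "'a \<Rightarrow> real" where f: "continuous_on UNIV f" "\<And>x. f x = 0 \<longleftrightarrow> x \<in> - U"
    using closed_zero_set[of "- U"] U by (auto simp: closed_Compl)
  \<comment> \<open>The first entry cuts the support down to \<open>U\<close>; staying below
    \<open>g\<close> preserves decay at infinity.\<close>
  define h where "h x = min \<bar>f x\<bar> (g x)" for x
  have g': "continuous_on UNIV g" "\<And>x. 0 \<le> g x" "\<And>e. e > 0 \<Longrightarrow> compact {x. e \<le> g x}"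
    using g by (auto simp: vanishing_def)
  have cont: "continuous_on UNIV h"
    unfolding h_def by (intro continuous_on_min continuous_on_rabs f g')
  have "compact {x. e \<le> h x}" if "e > 0" for e
  proof -
    have "closed {x. e \<le> h x}" by (intro closed_Collect_le cont continuous_on_const)
    then have "compact ({x. e \<le> g x} \<inter> {x. e \<le> h x})"
      by (rule compact_Int_closed[OF g'(3)[OF that]])
    moreover have "{x. e \<le> g x} \<inter> {x. e \<le> h x} = {x. e \<le> h x}" by (auto simp: h_def)
    ultimately show ?thesis by simp
  qed
  then have "vanishing h" using cont g'(2) by (simp add: vanishing_def h_def)
  moreover have "h x = 0 \<longleftrightarrow> x \<notin> U \<or> g x = 0" for x
    using f(2)[of x] g'(2)[of x] by (auto simp: h_def min_def)
  ultimately show ?thesis using that by blast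
qed

lemma pseudo_finite_family:
  assumes p: "p \<in> infinite_derived_set (one_point :: 'a option topology)"
  shows "\<exists>\<P> :: (nat \<Rightarrow> bool) \<Rightarrow> 'a set set.
    (\<forall>\<alpha> \<in> Field continuum.
       prime_z_filter TYPE('k::real_or_complex) (\<P> \<alpha>) \<and> z_filter_supported_at (\<P> \<alpha>) p) \<and>
    pseudo_finite (Field continuum) \<P> \<and>
    non_redundant (zero_sets TYPE('k)) (Field continuum) \<P> \<and>
    (let P = (\<lambda>\<alpha>. C0_fun \<inter> Z_inverse (\<P> \<alpha>)) :: (nat \<Rightarrow> bool) \<Rightarrow> ('a \<Rightarrow> 'k) set in
       (\<forall>\<alpha> \<in> Field continuum.
          C0_prime_ideal (P \<alpha>) \<and> C0_z_ideal (P \<alpha>) \<and> ideal_supported_at (P \<alpha>) p) \<and>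
       pseudo_finite (Field continuum) P \<and>
       non_redundant C0_fun (Field continuum) P \<and>
       (card_of (C0_quotient (\<Inter>\<alpha> \<in> Field continuum. P \<alpha>)), continuum) \<in> ordIso)"
proof -
  obtain \<gamma> :: "'a \<Rightarrow> real" and lam where \<gamma>: "continuous_on UNIV \<gamma>" "\<And>x. 0 \<le> \<gamma> x"
    "\<And>x. \<gamma> x = 0 \<longleftrightarrow> p = Some x"
    "\<And>q U. p = Some q \<Longrightarrow> open U \<Longrightarrow> q \<in> U \<Longrightarrow> \<exists>e>0. {x. \<gamma> x < e} \<subseteq> U"
    and lam: "labelling lam" "labels \<subseteq> ran lam"
    and far: "\<And>e \<alpha>. e > 0 \<Longrightarrow> \<not> positive_at lam \<alpha> {x. e \<le> \<gamma> x}"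
    by (rule labelled_neighbourhoods[OF p]) blast
  obtain \<U> where filter: "\<And>\<alpha>. open_filter (\<U> \<alpha>)"
    and prime: "\<And>\<alpha> U V. open U \<Longrightarrow> open V \<Longrightarrow> U \<union> V \<in> \<U> \<alpha> \<Longrightarrow> U \<in> \<U> \<alpha> \<or> V \<in> \<U> \<alpha>"
    and pos: "\<And>\<alpha> U. U \<in> \<U> \<alpha> \<Longrightarrow> positive_at lam \<alpha> U"
    and compl: "\<And>\<alpha> U. open U \<Longrightarrow> \<not> positive_at lam \<alpha> (- U) \<Longrightarrow> U \<in> \<U> \<alpha>"
    and fin: "\<And>\<alpha> U. open U \<Longrightarrow> U \<notin> \<U> \<alpha> \<Longrightarrow> finite {\<beta>. U \<in> \<U> \<beta>}"
    by (rule pseudo_finite_prime_open_filters[OF lam]) blast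
  \<comment> \<open>This duality exchanges the two axioms: primeness of \<open>\<U> \<alpha>\<close>
    becomes closure of \<open>\<P> \<alpha>\<close> under intersections, and closure of
    \<open>\<U> \<alpha>\<close> under intersections becomes primeness.\<close>
  define \<P> where "\<P> \<alpha> = {Z. closed Z \<and> - Z \<notin> \<U> \<alpha>}" for \<alpha>
  define P where "P \<alpha> = (C0_fun \<inter> Z_inverse (\<P> \<alpha>) :: ('a \<Rightarrow> 'k) set)" for \<alpha>
  define J where "J = (\<Inter>\<alpha>. P \<alpha>)"
  have P_iff: "f \<in> P \<alpha> \<longleftrightarrow> f \<in> C0_fun \<and> zero_set f \<in> \<P> \<alpha>" for f \<alpha>
    using C0_fun_subset_C_fun by (auto simp: P_def Z_inverse_def)
  have cl: "closed (zero_set f)" if "f \<in> C0_fun" for f :: "'a \<Rightarrow> 'k"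
    using closed_zero_set_C_fun C0_fun_subset_C_fun that by blast

  \<comment> \<open>Prime z-filters\<close>
  have z_filter: "z_filter TYPE('k) (\<P> \<alpha>)" for \<alpha>
    unfolding z_filter_def zero_sets_eq
  proof (intro conjI ballI impI)
    have "{} \<notin> \<U> \<alpha>" using pos positive_labelled by (metis empty_iff)
    then show "\<P> \<alpha> \<noteq> {}" unfolding \<P>_def by (auto intro!: exI[of _ UNIV])
    have "{} \<notin> \<P> \<alpha>" using open_filterD(2)[OF filter] by (simp add: \<P>_def)
    moreover have "\<P> \<alpha> \<subseteq> Collect closed" "{} \<in> Collect closed" by (auto simp: \<P>_def)
    ultimately show "\<P> \<alpha> \<subset> Collect closed" by blast
    show "Z1 \<inter> Z2 \<in> \<P> \<alpha>" if "Z1 \<in> \<P> \<alpha>" "Z2 \<in> \<P> \<alpha>" for Z1 Z2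
      using that prime[of "- Z1" "- Z2" \<alpha>]
      by (auto simp: \<P>_def Compl_Int open_Compl closed_Int)
    show "Z2 \<in> \<P> \<alpha>" if Z: "Z1 \<in> \<P> \<alpha>" "Z2 \<in> Collect closed" "Z1 \<subseteq> Z2" for Z1 Z2
    proof -
      have "- Z2 \<notin> \<U> \<alpha>"
      proof
        assume "- Z2 \<in> \<U> \<alpha>"
        then have "- Z1 \<in> \<U> \<alpha>"
          by (rule open_filterD(4)[OF filter]) (use Z in \<open>auto simp: \<P>_def open_Compl\<close>)
        then show False using Z(1) by (simp add: \<P>_def)
      qed
      then show ?thesis using Z(2) by (simp add: \<P>_def)
    qed
  qed
  have prime_filter: "prime_z_filter TYPE('k) (\<P> \<alpha>)" for \<alpha>
    unfolding prime_z_filter_def zero_sets_eq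
  proof (intro conjI ballI z_filter)
    fix Z1 Z2 assume "Z1 \<in> Collect closed - \<P> \<alpha>" "Z2 \<in> Collect closed - \<P> \<alpha>"
    then have "- Z1 \<inter> - Z2 \<in> \<U> \<alpha>"
      using open_filterD(3)[OF filter] by (simp add: \<P>_def)
    then show "Z1 \<union> Z2 \<notin> \<P> \<alpha>" by (simp add: \<P>_def)
  qed

  \<comment> \<open>Support at \<open>p\<close>\<close>
  have near: "{x. \<gamma> x < e} \<in> \<U> \<alpha>" if "e > 0" for e \<alpha>
  proof (rule compl)
    show "open {x. \<gamma> x < e}" by (intro open_Collect_less \<gamma>(1) continuous_on_const)
    have "- {x. \<gamma> x < e} = {x. e \<le> \<gamma> x}" by auto
    then show "\<not> positive_at lam \<alpha> (- {x. \<gamma> x < e})" using far[OF that] by simp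
  qed
  have at_point: "q \<in> Z" if q: "p = Some q" and Z: "Z \<in> \<P> \<alpha>" for q Z \<alpha>
  proof (rule ccontr)
    assume "q \<notin> Z"
    moreover have "open (- Z)" using Z by (simp add: \<P>_def open_Compl)
    ultimately obtain e where e: "e > 0" "{x. \<gamma> x < e} \<subseteq> - Z"
      using \<gamma>(4)[OF q, of "- Z"] by blast
    have "- Z \<in> \<U> \<alpha>" by (rule open_filterD(4)[OF filter near[OF e(1)] \<open>open (- Z)\<close> e(2)])
    then show False using Z by (simp add: \<P>_def)
  qed
  have at_infinity: "\<exists>f\<in>P \<alpha>. f x \<noteq> 0" if "p = None" for x \<alpha>
  proof -
    have \<gamma>x: "\<gamma> x > 0" using \<gamma>(2,3)[of x] that by (simp add: less_le)
    \<comment> \<open>A function that is nonzero at \<open>x\<close> but only where \<gamma> exceeds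
      \<open>\<gamma> x / 2\<close> has a cozero set that is not positive, so it belongs to the
      ideal and rules out support at \<open>x\<close>.\<close>
    define U where "U = {y. \<gamma> x / 2 < \<gamma> y}"
    have "open U" unfolding U_def by (intro open_Collect_less \<gamma>(1) continuous_on_const)
    obtain g where g: "vanishing g" "\<And>y. y \<in> closure {x} \<Longrightarrow> g y > 0"
      using vanishing_positive_on_closure[of "{x}"] by auto
    obtain h where h: "vanishing h" "\<And>y. h y = 0 \<longleftrightarrow> y \<notin> U \<or> g y = 0"
      using vanishing_restrict[OF g(1) \<open>open U\<close>] by blast
    define f where "f y = (of_real (h y) :: 'k)" for y
    have f: "f \<in> C0_fun" unfolding f_def by (rule vanishing_of_real[OF h(1)])
    have "- zero_set f \<notin> \<U> \<alpha>"
    proof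
      assume "- zero_set f \<in> \<U> \<alpha>"
      then have "positive_at lam \<alpha> {y. \<gamma> x / 2 \<le> \<gamma> y}"
        by (rule positive_mono[OF pos]) (auto simp: zero_set_def f_def h(2) U_def)
      then show False using far[of "\<gamma> x / 2"] \<gamma>x by simp
    qed
    then have "f \<in> P \<alpha>" using f cl by (simp add: P_iff \<P>_def)
    moreover have "x \<in> U" "g x \<noteq> 0" using \<gamma>x g(2)[of x] by (auto simp: U_def)
    then have "f x \<noteq> 0" by (simp add: f_def h(2))
    ultimately show ?thesis by blast
  qed
  have supp: "z_filter_supported_at (\<P> \<alpha>) p" for \<alpha>
  proof (cases p)
    case None
    have "\<exists>Z\<in>\<P> \<alpha>. x \<notin> Z" for x
      using at_infinity[OF None, of \<alpha> x] by (force simp: P_iff zero_set_def)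
    then show ?thesis using None by (auto simp: z_filter_supported_at_def)
  next
    case (Some q)
    then show ?thesis using at_point by (simp add: z_filter_supported_at_def)
  qed
  have supp_ideal: "ideal_supported_at (P \<alpha>) p" for \<alpha>
  proof (cases p)
    case None
    then show ?thesis using at_infinity by (auto simp: ideal_supported_at_def)
  next
    case (Some q)
    then have "f q = 0" if "f \<in> P \<alpha>" for f
      using at_point[of q "zero_set f" \<alpha>] that by (simp add: P_iff zero_set_def)
    then show ?thesis using Some by (simp add: ideal_supported_at_def)
  qed

  \<comment> \<open>Pseudo-finiteness\<close>
  have pf: "finite {\<alpha>. Z \<notin> \<P> \<alpha>}" if "Z \<in> \<P> \<beta>" for Z \<beta>
  proof -
    have "closed Z" "- Z \<notin> \<U> \<beta>" using that by (auto simp: \<P>_def)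
    then have "finite {\<alpha>. - Z \<in> \<U> \<alpha>}" by (intro fin) (auto simp: open_Compl)
    then show ?thesis using \<open>closed Z\<close> by (simp add: \<P>_def)
  qed
  have pseudo: "pseudo_finite UNIV \<P>"
    using pf by (auto simp: pseudo_finite_def)
  have pseudo_ideal: "pseudo_finite UNIV P"
    using pf by (auto simp: pseudo_finite_def P_iff)

  \<comment> \<open>Non-redundancy\<close>
  have countable_dom: "countable (dom lam)" using lam(1) by (simp add: labelling_def)
  \<comment> \<open>Cutting \<open>g\<close> down to a separating open set loses no labelled point
    of that set and stays in C_0, so the same functions serve for filters and ideals.\<close>
  obtain g where g: "vanishing g" "\<And>x. x \<in> closure (dom lam) \<Longrightarrow> g x > 0"
    using vanishing_positive_on_closure[OF countable_dom] by blast
  have g_dom: "g x \<noteq> 0" if "lam x = Some l" for x l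
    using g(2)[of x] subsetD[OF closure_subset[of "dom lam"] domI[of lam, OF that]] by simp
  have sep: "\<exists>f. f \<in> C0_fun \<and> (\<forall>\<beta>. f \<in> P \<beta> \<longleftrightarrow> \<beta> \<noteq> \<alpha>)" for \<alpha>
  proof -
    obtain U where U: "open U" "\<And>x n G. lam x = Some (res n \<alpha>, G) \<Longrightarrow> x \<in> U"
      "\<And>\<beta>. \<beta> \<noteq> \<alpha> \<Longrightarrow> \<not> positive_at lam \<beta> U"
      by (rule separating_open_set[OF lam(1), of \<alpha>]) blast
    obtain h where h: "vanishing h" "\<And>y. h y = 0 \<longleftrightarrow> y \<notin> U \<or> g y = 0"
      using vanishing_restrict[OF g(1) U(1)] by blast
    define f where "f y = (of_real (h y) :: 'k)" for y
    have f: "f \<in> C0_fun" unfolding f_def by (rule vanishing_of_real[OF h(1)])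
    have zf: "zero_set f = {y. y \<notin> U \<or> g y = 0}" by (auto simp: zero_set_def f_def h(2))
    have "\<not> positive_at lam \<alpha> (- (- zero_set f))"
    proof
      assume "positive_at lam \<alpha> (- (- zero_set f))"
      then obtain x n G where "x \<in> zero_set f" "lam x = Some (res n \<alpha>, G)"
        by (rule positive_labelled) auto
      then show False using U(2) g_dom by (auto simp: zf)
    qed
    then have "- zero_set f \<in> \<U> \<alpha>" by (intro compl open_Compl cl f)
    moreover have "- zero_set f \<notin> \<U> \<beta>" if "\<beta> \<noteq> \<alpha>" for \<beta>
    proof
      assume "- zero_set f \<in> \<U> \<beta>"
      then have "positive_at lam \<beta> U"
        by (rule positive_mono[OF pos]) (auto simp: zf)
      then show False using U(3)[OF that] by simp
    qed
    ultimately have "f \<in> P \<beta> \<longleftrightarrow> \<beta> \<noteq> \<alpha>" for \<beta>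
      using f cl by (auto simp: P_iff \<P>_def)
    with f show ?thesis by blast
  qed
  then obtain F where F: "\<And>\<alpha>. F \<alpha> \<in> C0_fun" "\<And>\<alpha> \<beta>. F \<alpha> \<in> P \<beta> \<longleftrightarrow> \<beta> \<noteq> \<alpha>"
    by metis
  have "non_redundant (Collect closed) UNIV \<P>"
  proof (rule non_redundantI)
    fix \<alpha>
    show "\<exists>Z\<in>Collect closed. Z \<notin> \<P> \<alpha> \<and> (\<forall>\<beta>\<in>UNIV. \<beta> \<noteq> \<alpha> \<longrightarrow> Z \<in> \<P> \<beta>)"
      using F[of \<alpha>] cl[OF F(1)[of \<alpha>]] by (intro bexI[of _ "zero_set (F \<alpha>)"]) (auto simp: P_iff)
  qed
  then have nr: "non_redundant (zero_sets TYPE('k)) UNIV \<P>" by (simp add: zero_sets_eq)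
  have nr_ideal: "non_redundant C0_fun UNIV P"
    using F by (intro non_redundantI) blast
  have proper: "P \<alpha> \<noteq> C0_fun" for \<alpha> using F by blast
  have prime_ideal: "C0_prime_ideal (P \<alpha>)" and z_ideal: "C0_z_ideal (P \<alpha>)" for \<alpha>
    using prime_z_filter_ideal[OF prime_filter proper[unfolded P_def]] by (simp_all add: P_def)

  \<comment> \<open>Cardinality of the quotient\<close>
  have ideal: "C0_ideal (P \<alpha>)" for \<alpha> using z_ideal by (simp add: C0_z_ideal_def)
  have ideal_add: "(\<lambda>x. f x + h x) \<in> P \<alpha>" if "f \<in> P \<alpha>" "h \<in> P \<alpha>" for f h \<alpha>
    using ideal[of \<alpha>] that by (simp add: C0_ideal_def)
  have ideal_scale: "(\<lambda>x. c * h x) \<in> P \<alpha>" if "h \<in> P \<alpha>" for c h \<alpha>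
    using ideal[of \<alpha>] that by (simp add: C0_ideal_def)
  have J_zero: "(\<lambda>x. 0) \<in> J" using ideal by (auto simp: J_def C0_ideal_def)
  have J_diff: "(\<lambda>x. f x - h x) \<in> J" if fh: "f \<in> J" "h \<in> J" for f h
    unfolding J_def
  proof
    fix \<alpha>
    have "f \<in> P \<alpha>" "h \<in> P \<alpha>" using fh by (auto simp: J_def)
    then have "(\<lambda>x. f x + (- 1) * h x) \<in> P \<alpha>" by (intro ideal_add ideal_scale)
    then show "(\<lambda>x. f x - h x) \<in> P \<alpha>" by simp
  qed
  define R where "R = {(f, h). f \<in> C0_fun \<and> h \<in> C0_fun \<and> (\<lambda>x. f x - h x) \<in> J}"
  have equiv: "equiv C0_fun R"
  proof (rule equivI)
    show "R \<subseteq> C0_fun \<times> C0_fun" by (auto simp: R_def)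
    show "refl_on C0_fun R" using J_zero by (auto simp: refl_on_def R_def)
    show "sym R"
    proof (rule symI)
      fix f h assume "(f, h) \<in> R"
      then have "f \<in> C0_fun" "h \<in> C0_fun" "(\<lambda>x. f x - h x) \<in> J" by (auto simp: R_def)
      then show "(h, f) \<in> R" using J_diff[OF J_zero, of "\<lambda>x. f x - h x"] by (simp add: R_def)
    qed
    show "trans R"
    proof (rule transI)
      fix f h k assume "(f, h) \<in> R" "(h, k) \<in> R"
      then have *: "f \<in> C0_fun" "k \<in> C0_fun" "(\<lambda>x. f x - h x) \<in> J" "(\<lambda>x. h x - k x) \<in> J"
        by (auto simp: R_def)
      have "(\<lambda>x. k x - h x) \<in> J" using J_diff[OF J_zero *(4)] by simp
      from J_diff[OF *(3) this] show "(f, k) \<in> R" using *(1,2) by (simp add: R_def)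
    qed
  qed
  have quot: "C0_quotient J = (\<lambda>f. R `` {f}) ` C0_fun"
    by (auto simp: C0_quotient_def R_def[symmetric] quotient_def)

  \<comment> \<open>The restriction \<open>r f\<close> to the labelled points determines
    \<open>f\<close> modulo \<open>J\<close>: a cozero set without labelled points is positive at no
    \<alpha>, so it lies in none of the filters \<open>\<U> \<alpha>\<close>.\<close>
  define e where "e = from_nat_into (dom lam)"
  define r where "r f = (\<lambda>i. f (e i))" for f :: "'a \<Rightarrow> 'k"
  have "R `` {f} = R `` {h}" if fh: "f \<in> C0_fun" "h \<in> C0_fun" "r f = r h" for f h
  proof (rule equiv_class_eq[OF equiv])
    have eq: "f x = h x" if "x \<in> dom lam" for x
      using from_nat_into_surj[OF countable_dom that] fun_cong[OF fh(3)]
      by (metis e_def r_def)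
    define k where "k = (\<lambda>x. f x - h x)"
    have k: "k \<in> C0_fun"
      using C0_fun_add[OF fh(1) C0_fun_scale[OF fh(2), of "- 1"]] by (simp add: k_def)
    have "- zero_set k \<notin> \<U> \<alpha>" for \<alpha>
    proof
      assume "- zero_set k \<in> \<U> \<alpha>"
      then obtain x n G where "x \<in> - zero_set k" "lam x = Some (res n \<alpha>, G)"
        using pos positive_labelled by metis
      then show False using eq by (auto simp: zero_set_def k_def dom_def)
    qed
    then have "k \<in> J" using k cl by (simp add: J_def P_iff \<P>_def)
    then show "(f, h) \<in> R" using fh by (simp add: R_def k_def)
  qed
  \<comment> \<open>Choosing a preimage of each restriction presents the quotient as an image of a
    set of scalar sequences.\<close>
  then have "C0_quotient J = (\<lambda>y. R `` {inv_into C0_fun r y}) ` (r ` C0_fun)"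
    unfolding quot image_image
    by (intro image_cong refl) (metis f_inv_into_f imageI inv_into_into)
  then have "(card_of (C0_quotient J), card_of (r ` C0_fun)) \<in> ordLeq"
    using card_of_image by metis
  then have "(card_of (C0_quotient J), card_of (UNIV :: (nat \<Rightarrow> 'k) set)) \<in> ordLeq"
    using card_of_mono1[of "r ` C0_fun" UNIV] ordLeq_transitive by blast
  then have upper: "(card_of (C0_quotient J), continuum) \<in> ordLeq"
    using card_sequences ordLeq_transitive by blast

  \<comment> \<open>The separating functions are pairwise incongruent, since for \<beta> different
    from \<alpha> the ideal \<open>P \<alpha>\<close> contains \<open>F \<beta>\<close> but not
    \<open>F \<alpha>\<close>.\<close>
  have "inj (\<lambda>\<alpha>. R `` {F \<alpha>})"
  proof (rule injI, rule ccontr)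
    fix \<alpha> \<beta> assume "R `` {F \<alpha>} = R `` {F \<beta>}" "\<alpha> \<noteq> \<beta>"
    then have "(F \<alpha>, F \<beta>) \<in> R"
      using eq_equiv_class[OF _ equiv F(1)] by blast
    then have "(\<lambda>x. F \<alpha> x - F \<beta> x) \<in> P \<alpha>" by (auto simp: R_def J_def)
    moreover have "F \<beta> \<in> P \<alpha>" using F(2) \<open>\<alpha> \<noteq> \<beta>\<close> by blast
    ultimately have "(\<lambda>x. (F \<alpha> x - F \<beta> x) + F \<beta> x) \<in> P \<alpha>" by (rule ideal_add)
    then show False using F(2)[of \<alpha> \<alpha>] by simp
  qed
  moreover have "range (\<lambda>\<alpha>. R `` {F \<alpha>}) \<subseteq> C0_quotient J"
    using F(1) by (auto simp: quot)
  ultimately have lower: "(continuum, card_of (C0_quotient J)) \<in> ordLeq"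
    unfolding continuum_eq card_of_ordLeq[symmetric] by blast
  have card: "(card_of (C0_quotient J), continuum) \<in> ordIso"
    using upper lower by (simp add: ordIso_iff_ordLeq)

  show ?thesis
    unfolding Field_continuum Let_def P_def[symmetric]
    by (intro exI[of _ \<P>], unfold P_def[symmetric])
       (use prime_filter supp pseudo nr prime_ideal z_ideal supp_ideal pseudo_ideal nr_ideal card
         in \<open>simp add: J_def\<close>)
qed

end

theorem theorem3p9:
  fixes p :: "'a::t2_space option"
  assumes "locally_compact_space (euclidean :: 'a topology)"
    and "metrizable_space (euclidean :: 'a topology)"
    and "p \<in> infinite_derived_set (Alexandroff_compactification (euclidean :: 'a topology))"
  shows "\<exists>\<P> :: (nat \<Rightarrow> bool) \<Rightarrow> 'a set set.
    (\<forall>\<alpha> \<in> Field continuum.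
       prime_z_filter TYPE('k::real_or_complex) (\<P> \<alpha>) \<and> z_filter_supported_at (\<P> \<alpha>) p) \<and>
    pseudo_finite (Field continuum) \<P> \<and>
    non_redundant (zero_sets TYPE('k)) (Field continuum) \<P> \<and>
    (let P = (\<lambda>\<alpha>. C0_fun \<inter> Z_inverse (\<P> \<alpha>)) :: (nat \<Rightarrow> bool) \<Rightarrow> ('a \<Rightarrow> 'k) set in
       (\<forall>\<alpha> \<in> Field continuum.
          C0_prime_ideal (P \<alpha>) \<and> C0_z_ideal (P \<alpha>) \<and> ideal_supported_at (P \<alpha>) p) \<and>
       pseudo_finite (Field continuum) P \<and>
       non_redundant C0_fun (Field continuum) P \<and>
       (card_of (C0_quotient (\<Inter>\<alpha> \<in> Field continuum. P \<alpha>)), continuum) \<in> ordIso)"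
proof -
  obtain M d where "Metric_space M d" "(euclidean :: 'a topology) = Metric_space.mtopology M d"
    using assms(2) unfolding metrizable_space_def by blast
  moreover from this have "M = UNIV"
    by (metis Metric_space.topspace_mtopology topspace_euclidean)
  ultimately interpret locally_compact_metric d
    using assms(1) by (intro locally_compact_metric.intro) simp_all
  show ?thesis by (rule pseudo_finite_family[OF assms(3)])
qed

end
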